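(* Let $G$ be a biautomatic group and let $H \leq G$ be a finitely generated abelian subgroup. Then the image of the canonical map $\operatorname{Comm}_G(H) \to \operatorname{Comm}(H)$ is finite. In particular, there exists a finite-index normal subgroup $\operatorname{Comm}_G^0(H) \unlhd \operatorname{Comm}_G(H)$ such that every element of $\operatorname{Comm}_G^0(H)$ centralises some finite-index subgroup of $H$.
   Context: Commensurators. For $H\le G$, the commensurator is $\operatorname{Comm}_G(H) := \{ g \in G \mid [H : H \cap gHg^{-1}] < \infty \text{ and } [H : H \cap g^{-1}Hg] < \infty \}$, a subgroup of $G$. The abstract commensurator $\operatorname{Comm}(H)$ of a group $H$ is the set of equivalence classes $[\varphi]$ of isomorphisms $\varphi\colon A\to B$ between finite-index subgroups $A,B$ of $H$, where two such isomorphisms are equivalent if they agree on some finite-index subgroup of $H$ contained in both domains; it is a group under $[\varphi][\varphi']=[\psi]$, where for $\varphi\colon A\to B$ and $\varphi'\colon A'\to B'$ the map $\psi\colon (\varphi')^{-1}(A\cap B')\to\varphi(A\cap B')$ is $\psi(h)=\varphi(\varphi'(h))$. The canonical map $\operatorname{Comm}_G(H)\to\operatorname{Comm}(H)$ is the group homomorphism sending $g$ to the class of $\varphi_g\colon H\cap g^{-1}Hg\to H\cap gHg^{-1}$, $\varphi_g(h)=ghg^{-1}$. Biautomatic groups. Let $G$ be a group with a finite generating set $Y$, viewed as an abstract alphabet with a fixed injective map $Y \hookrightarrow G$. Assume $Y$ is symmetric (its image $S$ in $G$ satisfies $S=S^{-1}$) and contains the identity (some element $1\in Y$ maps to $1_G$).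 $Y^*$ is the free monoid of words over $Y$; for $U\in Y^*$, $|U|$ is its length, $\overline{U}\in G$ is the element it represents, and for $t \in \mathbb{Z}_{\ge 0}$, $U(t)$ is the prefix of $U$ of length $t$ if $t\le |U|$ and $U(t)=U$ if $t>|U|$. For $g\in G$, $|g|_Y$ is the length of a shortest word in $Y^*$ representing $g$. A language $\mathcal{M}\subseteq Y^*$ is regular if it is recognised by a finite state automaton. A pair $(Y,\mathcal{M})$ with $\mathcal{M}\subseteq Y^*$ is a biautomatic structure for $G$ if $\mathcal{M}$ maps onto $G$ under $U\mapsto\overline{U}$, $\mathcal{M}$ is a regular language, and $\mathcal{M}$ has the two-sided fellow traveller property: there is a constant $\lambda\ge 0$ such that whenever $U,V\in\mathcal{M}$ and $x,y\in Y$ satisfy $\overline{U}=\overline{xVy}$, we have $\left|\overline{U(t)}^{-1}\,\overline{x}\,\overline{V(t)}\right|_Y\le\lambda$ for all $t\in\mathbb{Z}_{\ge 0}$. $G$ is biautomatic if it has a biautomatic structure. *)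

theory Defs
  imports Complex_Main "HOL-Algebra.Coset" "HOL-Algebra.Generated_Groups"
begin

section \<open>Subgroups of finite index and commensurators\<close>

definition finitely_generated :: "('a, 'b) monoid_scheme \<Rightarrow> bool" where
  "finitely_generated K \<longleftrightarrow>
     (\<exists>X. finite X \<and> X \<subseteq> carrier K \<and> generate K X = carrier K)"

definition finite_index :: "'a set \<Rightarrow> ('a, 'b) monoid_scheme \<Rightarrow> bool" where
  "finite_index A K \<longleftrightarrow> subgroup A K \<and> finite (rcosets\<^bsub>K\<^esub> A)"

definition conj_set :: "('a, 'b) monoid_scheme \<Rightarrow> 'a \<Rightarrow> 'a set \<Rightarrow> 'a set" where
  "conj_set G g H = (g <#\<^bsub>G\<^esub> H) #>\<^bsub>G\<^esub> (inv\<^bsub>G\<^esub> g)"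

definition commensurator :: "('a, 'b) monoid_scheme \<Rightarrow> 'a set \<Rightarrow> 'a set" where
  "commensurator G H =
     {g \<in> carrier G. finite_index (H \<inter> conj_set G g H) (G\<lparr>carrier := H\<rparr>) \<and>
                     finite_index (H \<inter> conj_set G (inv\<^bsub>G\<^esub> g) H) (G\<lparr>carrier := H\<rparr>)}"

section \<open>The abstract commensurator\<close>

text \<open>An isomorphism \<open>\<phi>: A \<rightarrow> B\<close> is encoded as a triple \<open>(A, B, \<phi>)\<close>, where \<open>\<phi>\<close> is
  \<open>undefined\<close> off \<open>A\<close>, so that triples correspond one-to-one to such isomorphisms.\<close>

type_synonym 'a partial_map = "'a set \<times> 'a set \<times> ('a \<Rightarrow> 'a)"

definition fi_isos :: "('a, 'b) monoid_scheme \<Rightarrow> 'a partial_map set" where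
  "fi_isos K = {(A, B, \<phi>). finite_index A K \<and> finite_index B K \<and>
     \<phi> \<in> iso (K\<lparr>carrier := A\<rparr>) (K\<lparr>carrier := B\<rparr>) \<and> \<phi> \<in> extensional A}"

definition comm_rel :: "('a, 'b) monoid_scheme \<Rightarrow> ('a partial_map \<times> 'a partial_map) set" where
  "comm_rel K = {((A, B, \<phi>), (A', B', \<phi>')).
     (A, B, \<phi>) \<in> fi_isos K \<and> (A', B', \<phi>') \<in> fi_isos K \<and>
     (\<exists>C. finite_index C K \<and> C \<subseteq> A \<inter> A' \<and> (\<forall>h\<in>C. \<phi> h = \<phi>' h))}"

definition comm_class :: "('a, 'b) monoid_scheme \<Rightarrow> 'a partial_map \<Rightarrow> 'a partial_map set" where
  "comm_class K p = comm_rel K `` {p}"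

fun pcomp :: "'a partial_map \<Rightarrow> 'a partial_map \<Rightarrow> 'a partial_map" where
  "pcomp (A, B, \<phi>) (A', B', \<phi>') =
     (let D = {h \<in> A'. \<phi>' h \<in> A \<inter> B'}
      in (D, \<phi> ` (A \<inter> B'), restrict (\<lambda>h. \<phi> (\<phi>' h)) D))"

text \<open>The union in the product is over all representatives; it is a single class because the
  class of the composite does not depend on them (see \<open>class_mult\<close> below).\<close>

definition abstract_commensurator :: "('a, 'b) monoid_scheme \<Rightarrow> 'a partial_map set monoid" where
  "abstract_commensurator K =
     \<lparr>carrier = fi_isos K // comm_rel K,
      mult = (\<lambda>X Y. \<Union>x\<in>X. \<Union>y\<in>Y. comm_class K (pcomp x y)),
      one = comm_class K (carrier K, carrier K, restrict (\<lambda>h. h) (carrier K))\<rparr>"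

definition conj_iso :: "('a, 'b) monoid_scheme \<Rightarrow> 'a set \<Rightarrow> 'a \<Rightarrow> 'a partial_map" where
  "conj_iso G H g =
     (H \<inter> conj_set G (inv\<^bsub>G\<^esub> g) H, H \<inter> conj_set G g H,
      restrict (\<lambda>h. g \<otimes>\<^bsub>G\<^esub> h \<otimes>\<^bsub>G\<^esub> inv\<^bsub>G\<^esub> g) (H \<inter> conj_set G (inv\<^bsub>G\<^esub> g) H))"

definition canonical_map :: "('a, 'b) monoid_scheme \<Rightarrow> 'a set \<Rightarrow> 'a \<Rightarrow> 'a partial_map set" where
  "canonical_map G H g = comm_class (G\<lparr>carrier := H\<rparr>) (conj_iso G H g)"

section \<open>Biautomatic groups\<close>

text \<open>Recognition by a finite (deterministic, complete) automaton over the alphabet \<open>Y\<close>.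
  As the state set is finite, taking the states to be natural numbers is no restriction.\<close>

definition regular_language :: "'y set \<Rightarrow> 'y list set \<Rightarrow> bool" where
  "regular_language Y M \<longleftrightarrow>
     (\<exists>(Q :: nat set) q\<^sub>0 \<delta> F. finite Q \<and> q\<^sub>0 \<in> Q \<and> F \<subseteq> Q \<and>
        (\<forall>q\<in>Q. \<forall>y\<in>Y. \<delta> q y \<in> Q) \<and>
        M = {w \<in> lists Y. foldl \<delta> q\<^sub>0 w \<in> F})"

definition word_val :: "('a, 'b) monoid_scheme \<Rightarrow> ('y \<Rightarrow> 'a) \<Rightarrow> 'y list \<Rightarrow> 'a" where
  "word_val G \<iota> w = foldr (\<lambda>y g. \<iota> y \<otimes>\<^bsub>G\<^esub> g) w \<one>\<^bsub>G\<^esub>"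

definition word_length :: "('a, 'b) monoid_scheme \<Rightarrow> 'y set \<Rightarrow> ('y \<Rightarrow> 'a) \<Rightarrow> 'a \<Rightarrow> nat" where
  "word_length G Y \<iota> g = (LEAST n. \<exists>w \<in> lists Y. length w = n \<and> word_val G \<iota> w = g)"

definition generating_alphabet :: "('a, 'b) monoid_scheme \<Rightarrow> 'y set \<Rightarrow> ('y \<Rightarrow> 'a) \<Rightarrow> bool" where
  "generating_alphabet G Y \<iota> \<longleftrightarrow>
     finite Y \<and> inj_on \<iota> Y \<and> \<iota> ` Y \<subseteq> carrier G \<and> generate G (\<iota> ` Y) = carrier G \<and>
     set_inv\<^bsub>G\<^esub> (\<iota> ` Y) = \<iota> ` Y \<and> \<one>\<^bsub>G\<^esub> \<in> \<iota> ` Y"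

definition two_sided_fellow_traveller ::
  "('a, 'b) monoid_scheme \<Rightarrow> 'y set \<Rightarrow> ('y \<Rightarrow> 'a) \<Rightarrow> 'y list set \<Rightarrow> bool" where
  "two_sided_fellow_traveller G Y \<iota> M \<longleftrightarrow>
     (\<exists>L::real. L \<ge> 0 \<and>
        (\<forall>U\<in>M. \<forall>V\<in>M. \<forall>x\<in>Y. \<forall>y\<in>Y. word_val G \<iota> U = word_val G \<iota> (x # V @ [y]) \<longrightarrow>
           (\<forall>t::nat. real (word_length G Y \<iota>
              (inv\<^bsub>G\<^esub> (word_val G \<iota> (take t U)) \<otimes>\<^bsub>G\<^esub> \<iota> x \<otimes>\<^bsub>G\<^esub> word_val G \<iota> (take t V))) \<le> L)))"

definition biautomatic_structure ::
  "('a, 'b) monoid_scheme \<Rightarrow> 'y set \<Rightarrow> ('y \<Rightarrow> 'a) \<Rightarrow> 'y list set \<Rightarrow> bool" where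
  "biautomatic_structure G Y \<iota> M \<longleftrightarrow>
     generating_alphabet G Y \<iota> \<and> M \<subseteq> lists Y \<and> word_val G \<iota> ` M = carrier G \<and>
     regular_language Y M \<and> two_sided_fellow_traveller G Y \<iota> M"

text \<open>Alphabets are finite, so taking the letters to be natural numbers is no restriction.\<close>

definition biautomatic :: "('a, 'b) monoid_scheme \<Rightarrow> bool" where
  "biautomatic G \<longleftrightarrow> (\<exists>(Y :: nat set) \<iota> M. biautomatic_structure G Y \<iota> M)"

section \<open>Well-definedness of the commensurator constructions\<close>

text \<open>The commensurator is a subgroup (\<open>commensurator_subgroup\<close>), the abstract commensurator
  is a group (\<open>group_abstract_commensurator\<close>), and the canonical map is a homomorphism between
  them (\<open>canonical_map_hom\<close>).\<close>

context group begin

lemma finite_index_Int: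
  assumes "finite_index A G" "finite_index B G"
  shows "finite_index (A \<inter> B) G"
proof -
  have sA: "subgroup A G" and sB: "subgroup B G" and fA: "finite (rcosets A)" and fB: "finite (rcosets B)"
    using assms by (auto simp: finite_index_def)
  have eq: "(A \<inter> B) #> x = (A #> x) \<inter> (B #> x)" if x: "x \<in> carrier G" for x
  proof -
    have "a = b" if "a \<in> A" "b \<in> B" "a \<otimes> x = b \<otimes> x" for a b
      using that x sA sB by (meson right_cancel subgroup.mem_carrier)
    then show ?thesis unfolding r_coset_def by blast
  qed
  have "rcosets (A \<inter> B) \<subseteq> (\<lambda>(C, D). C \<inter> D) ` ((rcosets A) \<times> (rcosets B))"
    unfolding RCOSETS_def using eq by force
  then have "finite (rcosets (A \<inter> B))"
    by (rule finite_subset) (use fA fB in auto)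
  then show ?thesis using sA sB by (simp add: finite_index_def subgroups_Inter_pair)
qed

lemma finite_index_mono:
  assumes "finite_index A G" "subgroup B G" "A \<subseteq> B"
  shows "finite_index B G"
proof -
  have sA: "subgroup A G" and fA: "finite (rcosets A)" using assms by (auto simp: finite_index_def)
  have BA: "B <#> A = B"
  proof
    show "B <#> A \<subseteq> B" using assms by (auto simp: set_mult_def subgroup.m_closed)
    show "B \<subseteq> B <#> A"
    proof
      fix b assume "b \<in> B"
      then have "b = b \<otimes> \<one>" "\<one> \<in> A" using sA assms by (auto simp: subgroup.one_closed subgroup.mem_carrier)
      then show "b \<in> B <#> A" using \<open>b \<in> B\<close> unfolding set_mult_def by blast
    qed
  qed
  have "B #> x = B <#> (A #> x)" if "x \<in> carrier G" for x
    using that BA assms sA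
    by (metis setmult_rcos_assoc subgroup.subset)
  then have "rcosets B \<subseteq> (\<lambda>C. B <#> C) ` (rcosets A)" unfolding RCOSETS_def by blast
  then show ?thesis using fA assms(2) by (meson finite_imageI finite_index_def finite_subset)
qed

lemma finite_index_carrier: "finite_index (carrier G) G"
proof -
  have "rcosets (carrier G) \<subseteq> {carrier G}"
    unfolding RCOSETS_def using coset_join2 subgroup_self by auto
  then show ?thesis using finite_subset subgroup_self unfolding finite_index_def by blast
qed

lemma finite_index_sub:
  assumes "finite_index C G" "C \<subseteq> B" "subgroup B G"
  shows "finite_index C (G\<lparr>carrier := B\<rparr>)"
proof -
  have "rcosets\<^bsub>G\<lparr>carrier := B\<rparr>\<^esub> C \<subseteq> rcosets C"
    unfolding RCOSETS_def using subgroup.subset[OF assms(3)] by auto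
  moreover have "subgroup C (G\<lparr>carrier := B\<rparr>)" using assms by (simp add: finite_index_def subgroup_incl)
  ultimately show ?thesis using assms finite_subset unfolding finite_index_def by blast
qed

lemma finite_index_trans:
  assumes A: "finite_index A G" and D: "finite_index D (G\<lparr>carrier := A\<rparr>)"
  shows "finite_index D G"
proof -
  have sA: "subgroup A G" and fA: "finite (rcosets A)" using assms by (auto simp: finite_index_def)
  have sD: "subgroup D G" using D sA incl_subgroup by (auto simp: finite_index_def)
  have DA: "D \<subseteq> A" using D subgroup.subset unfolding finite_index_def by fastforce
  obtain T where T: "finite T" "T \<subseteq> carrier G" "rcosets A = (\<lambda>x. A #> x) ` T"
    using finite_subset_image[of "rcosets A" "\<lambda>x. A #> x" "carrier G"] fA
    unfolding RCOSETS_def by blast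
  have "rcosets D \<subseteq> (\<lambda>(E, t). E #> t) ` ((rcosets\<^bsub>G\<lparr>carrier := A\<rparr>\<^esub> D) \<times> T)"
  proof
    fix X assume "X \<in> rcosets D"
    then obtain x where x: "x \<in> carrier G" "X = D #> x" unfolding RCOSETS_def by auto
    have "A #> x \<in> rcosets A" using x unfolding RCOSETS_def by auto
    then obtain t where t: "t \<in> T" "A #> x = A #> t" using T by auto
    have "x \<in> A #> t" using t x sA rcos_self by metis
    then obtain a where a: "a \<in> A" "x = a \<otimes> t" unfolding r_coset_def by auto
    have "X = (D #> a) #> t" using x a t T sD sA
      by (metis coset_mult_assoc subgroup.mem_carrier subgroup.subset subsetD)
    moreover have "D #> a \<in> rcosets\<^bsub>G\<lparr>carrier := A\<rparr>\<^esub> D" using a unfolding RCOSETS_def by auto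
    ultimately show "X \<in> (\<lambda>(E, t). E #> t) ` ((rcosets\<^bsub>G\<lparr>carrier := A\<rparr>\<^esub> D) \<times> T)" using t by force
  qed
  then have "finite (rcosets D)" by (rule finite_subset) (use D T in \<open>auto simp: finite_index_def\<close>)
  then show ?thesis using sD by (simp add: finite_index_def)
qed

end

lemma finite_index_preimage_hom:
  assumes "group K" "group L" "\<phi> \<in> hom K L" "finite_index C L"
  shows "finite_index {h \<in> carrier K. \<phi> h \<in> C} K"
proof -
  interpret group_hom K L \<phi> using assms by (simp add: group_hom_def group_hom_axioms_def)
  have sC: "subgroup C L" and fC: "finite (rcosets\<^bsub>L\<^esub> C)" using assms(4) by (auto simp: finite_index_def)
  let ?D = "{h \<in> carrier K. \<phi> h \<in> C}"
  have sD: "subgroup ?D K"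
    by (rule subgroup.intro) (auto simp: subgroup.m_closed[OF sC] subgroup.one_closed[OF sC] subgroup.m_inv_closed[OF sC])
  have "?D #>\<^bsub>K\<^esub> x = {h \<in> carrier K. \<phi> h \<in> C #>\<^bsub>L\<^esub> \<phi> x}" if x: "x \<in> carrier K" for x
  proof
    show "?D #>\<^bsub>K\<^esub> x \<subseteq> {h \<in> carrier K. \<phi> h \<in> C #>\<^bsub>L\<^esub> \<phi> x}"
      using x by (auto simp: r_coset_def)
    show "{h \<in> carrier K. \<phi> h \<in> C #>\<^bsub>L\<^esub> \<phi> x} \<subseteq> ?D #>\<^bsub>K\<^esub> x"
    proof clarify
      fix h assume h: "h \<in> carrier K" "\<phi> h \<in> C #>\<^bsub>L\<^esub> \<phi> x"
      then obtain c where c: "c \<in> C" "\<phi> h = c \<otimes>\<^bsub>L\<^esub> \<phi> x" by (auto simp: r_coset_def)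
      have cL: "c \<in> carrier L" using c sC subgroup.mem_carrier by metis
      have "\<phi> (h \<otimes>\<^bsub>K\<^esub> inv\<^bsub>K\<^esub> x) = c" using h c x cL by (simp add: H.m_assoc)
      then have "h \<otimes>\<^bsub>K\<^esub> inv\<^bsub>K\<^esub> x \<in> ?D" using c h x by auto
      moreover have "h = (h \<otimes>\<^bsub>K\<^esub> inv\<^bsub>K\<^esub> x) \<otimes>\<^bsub>K\<^esub> x" using h x by (simp add: G.m_assoc)
      ultimately show "h \<in> ?D #>\<^bsub>K\<^esub> x" unfolding r_coset_def by blast
    qed
  qed
  then have "rcosets\<^bsub>K\<^esub> ?D \<subseteq> (\<lambda>E. {h \<in> carrier K. \<phi> h \<in> E}) ` (rcosets\<^bsub>L\<^esub> C)"
    using H.rcosetsI[OF subgroup.subset[OF sC]] hom_closed by (auto simp: RCOSETS_def[of K])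
  then show ?thesis using sD fC by (meson finite_imageI finite_index_def finite_subset)
qed

context group begin

lemma fi_isosD:
  assumes "(A, B, \<phi>) \<in> fi_isos G"
  shows "finite_index A G" "finite_index B G" "subgroup A G" "subgroup B G"
    "\<phi> ` A = B" "inj_on \<phi> A" "\<And>x. x \<in> A \<Longrightarrow> \<phi> x \<in> B"
    "\<And>x y. x \<in> A \<Longrightarrow> y \<in> A \<Longrightarrow> \<phi> (x \<otimes> y) = \<phi> x \<otimes> \<phi> y" "\<phi> \<in> extensional A"
    "group_hom (G\<lparr>carrier := A\<rparr>) (G\<lparr>carrier := B\<rparr>) \<phi>"
proof -
  show s: "finite_index A G" "finite_index B G" "subgroup A G" "subgroup B G" "\<phi> \<in> extensional A"
    "\<phi> ` A = B" "inj_on \<phi> A" "\<And>x. x \<in> A \<Longrightarrow> \<phi> x \<in> B"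
    "\<And>x y. x \<in> A \<Longrightarrow> y \<in> A \<Longrightarrow> \<phi> (x \<otimes> y) = \<phi> x \<otimes> \<phi> y"
    using assms by (auto simp: fi_isos_def iso_def hom_def bij_betw_def finite_index_def)
  show "group_hom (G\<lparr>carrier := A\<rparr>) (G\<lparr>carrier := B\<rparr>) \<phi>"
    using assms s(3,4) by (auto simp: group_hom_def group_hom_axioms_def subgroup_imp_group fi_isos_def iso_def)
qed

lemma fi_isosI:
  assumes "finite_index A G" "finite_index B G" "bij_betw \<phi> A B" "\<phi> \<in> extensional A"
    "\<And>x y. x \<in> A \<Longrightarrow> y \<in> A \<Longrightarrow> \<phi> (x \<otimes> y) = \<phi> x \<otimes> \<phi> y"
  shows "(A, B, \<phi>) \<in> fi_isos G"
  using assms by (auto simp: fi_isos_def iso_def hom_def bij_betw_def)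

lemma fi_preimage:
  assumes p: "(A, B, \<phi>) \<in> fi_isos G" and C: "finite_index C G"
  shows "finite_index {h \<in> A. \<phi> h \<in> C} G"
proof -
  note d = fi_isosD[OF p]
  interpret f: group_hom "G\<lparr>carrier := A\<rparr>" "G\<lparr>carrier := B\<rparr>" \<phi> by (rule d)
  have "finite_index (C \<inter> B) (G\<lparr>carrier := B\<rparr>)"
    by (rule finite_index_sub) (simp_all add: group.finite_index_Int[OF is_group C d(2)] d(4))
  from finite_index_preimage_hom[OF f.G.is_group f.H.is_group f.homh this]
  have "finite_index {h \<in> A. \<phi> h \<in> C \<inter> B} (G\<lparr>carrier := A\<rparr>)" by simp
  moreover have "{h \<in> A. \<phi> h \<in> C \<inter> B} = {h \<in> A. \<phi> h \<in> C}" using d(7) by auto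
  ultimately show ?thesis using finite_index_trans d(1) by simp
qed

lemma pinv_in:
  assumes p: "(A, B, \<phi>) \<in> fi_isos G"
  shows "(B, A, restrict (inv_into A \<phi>) B) \<in> fi_isos G"
proof (rule fi_isosI)
  note d = fi_isosD[OF p]
  have b: "bij_betw \<phi> A B" using d by (simp add: bij_betw_def)
  show "bij_betw (restrict (inv_into A \<phi>) B) B A"
    using bij_betw_inv_into[OF b] by (simp cong: bij_betw_cong)
  fix x y assume xy: "x \<in> B" "y \<in> B"
  then obtain u v where uv: "u \<in> A" "v \<in> A" "x = \<phi> u" "y = \<phi> v" using d(5) by blast
  have "u \<otimes> v \<in> A" "x \<otimes> y \<in> B" using uv xy d(3,4) by (auto simp: subgroup.m_closed)
  moreover have "x \<otimes> y = \<phi> (u \<otimes> v)" using uv d by simp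
  ultimately show "restrict (inv_into A \<phi>) B (x \<otimes> y) = restrict (inv_into A \<phi>) B x \<otimes> restrict (inv_into A \<phi>) B y"
    using uv xy d(6) by simp
qed (use fi_isosD[OF p] in auto)

lemma fi_image:
  assumes p: "(A, B, \<phi>) \<in> fi_isos G" and C: "finite_index C G" "C \<subseteq> A"
  shows "finite_index (\<phi> ` C) G"
proof -
  note d = fi_isosD[OF p]
  have "{h \<in> B. restrict (inv_into A \<phi>) B h \<in> C} = \<phi> ` C"
  proof (intro subset_antisym subsetI)
    fix h assume "h \<in> {h \<in> B. restrict (inv_into A \<phi>) B h \<in> C}"
    then have h: "h \<in> \<phi> ` A" "inv_into A \<phi> h \<in> C" using d(5) by auto
    then show "h \<in> \<phi> ` C" by (metis f_inv_into_f image_eqI)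
  next
    fix h assume "h \<in> \<phi> ` C"
    then obtain c where c: "c \<in> C" "h = \<phi> c" by blast
    then have "c \<in> A" using C(2) by blast
    then show "h \<in> {h \<in> B. restrict (inv_into A \<phi>) B h \<in> C}"
      using c d(6) d(7)[of c] by simp
  qed
  then show ?thesis using fi_preimage[OF pinv_in[OF p] C(1)] by simp
qed

lemma pcomp_in:
  assumes p: "p \<in> fi_isos G" and q: "q \<in> fi_isos G"
  shows "pcomp p q \<in> fi_isos G"
proof -
  obtain A B \<phi> A' B' \<phi>' where pq: "p = (A, B, \<phi>)" "q = (A', B', \<phi>')" by (metis prod_cases3)
  note d = fi_isosD[OF p[unfolded pq]] and d' = fi_isosD[OF q[unfolded pq]]
  define D where "D = {h \<in> A'. \<phi>' h \<in> A \<inter> B'}"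
  have "(D, \<phi> ` (A \<inter> B'), restrict (\<lambda>h. \<phi> (\<phi>' h)) D) \<in> fi_isos G"
  proof (rule fi_isosI)
    show "finite_index D G" unfolding D_def
      using fi_preimage[OF q[unfolded pq]] finite_index_Int d(1) d'(2) by blast
    show "finite_index (\<phi> ` (A \<inter> B')) G"
      by (rule fi_image[OF p[unfolded pq]]) (use d d' finite_index_Int in auto)
    have im: "\<phi>' ` D = A \<inter> B'" using d'(5) by (auto simp: D_def)
    have "(\<lambda>h. \<phi> (\<phi>' h)) ` D = \<phi> ` (A \<inter> B')" using im by (metis image_image)
    moreover have "inj_on (\<lambda>h. \<phi> (\<phi>' h)) D"
      using d(6) d'(6) by (auto simp: inj_on_def D_def)
    ultimately show "bij_betw (restrict (\<lambda>h. \<phi> (\<phi>' h)) D) D (\<phi> ` (A \<inter> B'))"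
      by (auto simp: bij_betw_def inj_on_def)
    fix x y assume xy: "x \<in> D" "y \<in> D"
    then have "x \<otimes> y \<in> D" using d d' by (auto simp: D_def subgroup.m_closed)
    then show "restrict (\<lambda>h. \<phi> (\<phi>' h)) D (x \<otimes> y) = restrict (\<lambda>h. \<phi> (\<phi>' h)) D x \<otimes> restrict (\<lambda>h. \<phi> (\<phi>' h)) D y"
      using xy d d' by (auto simp: D_def)
  qed simp
  then show ?thesis by (simp add: pq D_def Let_def)
qed

lemma comm_rel_iff:
  "((A, B, f), (A', B', f')) \<in> comm_rel G \<longleftrightarrow>
     (A, B, f) \<in> fi_isos G \<and> (A', B', f') \<in> fi_isos G \<and>
     (\<exists>C. finite_index C G \<and> C \<subseteq> A \<inter> A' \<and> (\<forall>h\<in>C. f h = f' h))"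
  by (simp add: comm_rel_def)

lemma equiv_comm_rel: "equiv (fi_isos G) (comm_rel G)"
proof (rule equivI)
  show "comm_rel G \<subseteq> fi_isos G \<times> fi_isos G"
    by (rule subrelI) (simp add: comm_rel_def split_paired_all)
  show "refl_on (fi_isos G) (comm_rel G)"
  proof (rule refl_onI)
    fix p assume p: "p \<in> fi_isos G"
    obtain A B f where q: "p = (A, B, f)" by (rule prod_cases3)
    show "(p, p) \<in> comm_rel G"
      using p fi_isosD(1)[OF p[unfolded q]] unfolding q comm_rel_iff by blast
  qed
  show "sym (comm_rel G)"
  proof (rule symI)
    fix p q assume pq: "(p, q) \<in> comm_rel G"
    obtain A B f A' B' f' where e: "p = (A, B, f)" "q = (A', B', f')" by (metis prod_cases3)
    show "(q, p) \<in> comm_rel G"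
      using pq unfolding e comm_rel_iff by (metis Int_commute)
  qed
  show "trans (comm_rel G)"
  proof (rule transI)
    fix x y z assume xy: "(x, y) \<in> comm_rel G" and yz: "(y, z) \<in> comm_rel G"
    obtain A B f where x: "x = (A, B, f)" by (rule prod_cases3)
    obtain A' B' f' where y: "y = (A', B', f')" by (rule prod_cases3)
    obtain A'' B'' f'' where z: "z = (A'', B'', f'')" by (rule prod_cases3)
    obtain C where C: "finite_index C G" "C \<subseteq> A \<inter> A'" "\<forall>h\<in>C. f h = f' h"
      using xy unfolding x y comm_rel_iff by blast
    obtain D where D: "finite_index D G" "D \<subseteq> A' \<inter> A''" "\<forall>h\<in>D. f' h = f'' h"
      using yz unfolding y z comm_rel_iff by blast
    have "finite_index (C \<inter> D) G" using finite_index_Int[OF C(1) D(1)] .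
    moreover have "C \<inter> D \<subseteq> A \<inter> A''" "\<forall>h\<in>C \<inter> D. f h = f'' h" using C D by auto
    ultimately show "(x, z) \<in> comm_rel G"
      using xy yz unfolding x y z comm_rel_iff by blast
  qed
qed

lemma pcomp_congruent:
  assumes "(p, p') \<in> comm_rel G" "(q, q') \<in> comm_rel G"
  shows "(pcomp p q, pcomp p' q') \<in> comm_rel G"
proof -
  obtain A B f A' B' f' where p: "p = (A, B, f)" "p' = (A', B', f')" by (metis prod_cases3)
  obtain X Y g X' Y' g' where q: "q = (X, Y, g)" "q' = (X', Y', g')" by (metis prod_cases3)
  obtain C where C: "finite_index C G" "C \<subseteq> A \<inter> A'" "\<forall>h\<in>C. f h = f' h"
    and P: "(A, B, f) \<in> fi_isos G" "(A', B', f') \<in> fi_isos G"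
    using assms(1) unfolding p comm_rel_iff by blast
  obtain D where D: "finite_index D G" "D \<subseteq> X \<inter> X'" "\<forall>h\<in>D. g h = g' h"
    and Q: "(X, Y, g) \<in> fi_isos G" "(X', Y', g') \<in> fi_isos G"
    using assms(2) unfolding q comm_rel_iff by blast
  define E where "E = D \<inter> {h \<in> X. g h \<in> C}"
  have E: "finite_index E G" unfolding E_def by (intro finite_index_Int D fi_preimage[OF Q(1)] C)
  have E': "E \<subseteq> {h \<in> X. g h \<in> A \<inter> Y} \<inter> {h \<in> X'. g' h \<in> A' \<inter> Y'}"
  proof
    fix h assume "h \<in> E"
    then have h: "h \<in> X" "h \<in> X'" "g h \<in> C" "g' h = g h" using D by (auto simp: E_def)
    have "g h \<in> Y" "g' h \<in> Y'" using fi_isosD(7)[OF Q(1) h(1)] fi_isosD(7)[OF Q(2) h(2)] .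
    then show "h \<in> {h \<in> X. g h \<in> A \<inter> Y} \<inter> {h \<in> X'. g' h \<in> A' \<inter> Y'}"
      using h C(2) by auto
  qed
  have "\<forall>h\<in>E. f (g h) = f' (g' h)" using C(3) D(3) by (auto simp: E_def)
  then have e: "\<forall>h\<in>E. restrict (\<lambda>h. f (g h)) {h \<in> X. g h \<in> A \<inter> Y} h =
      restrict (\<lambda>h. f' (g' h)) {h \<in> X'. g' h \<in> A' \<inter> Y'} h"
    using E' by (auto simp: restrict_def)
  have "pcomp p q \<in> fi_isos G" "pcomp p' q' \<in> fi_isos G" using pcomp_in P Q p q by auto
  then show ?thesis
    using E E' e unfolding p q pcomp.simps Let_def comm_rel_iff by blast
qed

lemma class_mult:
  assumes p: "p \<in> fi_isos G" and q: "q \<in> fi_isos G"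
  shows "comm_class G p \<otimes>\<^bsub>abstract_commensurator G\<^esub> comm_class G q = comm_class G (pcomp p q)"
proof -
  have eq: "comm_class G (pcomp x y) = comm_class G (pcomp p q)"
    if "x \<in> comm_class G p" "y \<in> comm_class G q" for x y
  proof -
    have "(p, x) \<in> comm_rel G" "(q, y) \<in> comm_rel G" using that by (simp_all add: comm_class_def)
    then have "(pcomp p q, pcomp x y) \<in> comm_rel G" by (rule pcomp_congruent)
    then show ?thesis unfolding comm_class_def by (rule equiv_class_eq[OF equiv_comm_rel, symmetric])
  qed
  have "p \<in> comm_class G p" "q \<in> comm_class G q"
    unfolding comm_class_def by (rule equiv_class_self[OF equiv_comm_rel], fact)+
  then have "(\<Union>x\<in>comm_class G p. \<Union>y\<in>comm_class G q. comm_class G (pcomp x y)) = comm_class G (pcomp p q)"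
    using eq by blast
  then show ?thesis by (simp add: abstract_commensurator_def)
qed

lemma class_eqI:
  assumes "(A, B, f) \<in> fi_isos G" "(A', B', f') \<in> fi_isos G" "finite_index C G"
    "C \<subseteq> A \<inter> A'" "\<And>h. h \<in> C \<Longrightarrow> f h = f' h"
  shows "comm_class G (A, B, f) = comm_class G (A', B', f')"
  unfolding comm_class_def
  by (rule equiv_class_eq[OF equiv_comm_rel]) (use assms in \<open>unfold comm_rel_iff, blast\<close>)

lemma class_in:
  assumes "p \<in> fi_isos G" shows "comm_class G p \<in> carrier (abstract_commensurator G)"
  using assms by (simp add: abstract_commensurator_def comm_class_def quotientI)

lemma class_cases:
  assumes "X \<in> carrier (abstract_commensurator G)"
  obtains A B f where "(A, B, f) \<in> fi_isos G" "X = comm_class G (A, B, f)"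
proof -
  have "X \<in> fi_isos G // comm_rel G" using assms by (simp add: abstract_commensurator_def)
  then obtain p where p: "p \<in> fi_isos G" "X = comm_class G p"
    unfolding comm_class_def by (rule quotientE)
  obtain A B f where "p = (A, B, f)" by (rule prod_cases3)
  with p that show thesis by blast
qed

lemma pid_in: "(carrier G, carrier G, restrict (\<lambda>h. h) (carrier G)) \<in> fi_isos G"
  by (rule fi_isosI) (auto simp: finite_index_carrier bij_betw_def inj_on_def)

theorem group_abstract_commensurator: "group (abstract_commensurator G)"
proof (rule groupI)
  let ?C = "abstract_commensurator G"
  have one: "\<one>\<^bsub>?C\<^esub> = comm_class G (carrier G, carrier G, restrict (\<lambda>h. h) (carrier G))"
    by (simp add: abstract_commensurator_def)
  show "\<one>\<^bsub>?C\<^esub> \<in> carrier ?C" by (simp add: one class_in pid_in)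
  fix x assume "x \<in> carrier ?C"
  then obtain A B f where x: "(A, B, f) \<in> fi_isos G" "x = comm_class G (A, B, f)" by (rule class_cases)
  note d = fi_isosD[OF x(1)]
  have Bc: "B \<subseteq> carrier G" using d(4) subgroup.subset by blast
  have "{h \<in> A. f h \<in> carrier G \<inter> B} = A" using d(7) Bc by auto
  moreover have "carrier G \<inter> B = B" using Bc by blast
  moreover have "restrict (\<lambda>h. h) (carrier G) ` B = B" using Bc by auto
  moreover have "restrict (\<lambda>h. restrict (\<lambda>h. h) (carrier G) (f h)) A = f"
    using d(7,9) Bc by (intro extensionalityI[of _ A]) auto
  ultimately have "pcomp (carrier G, carrier G, restrict (\<lambda>h. h) (carrier G)) (A, B, f) = (A, B, f)"
    by (simp only: pcomp.simps Let_def)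
  then show "\<one>\<^bsub>?C\<^esub> \<otimes>\<^bsub>?C\<^esub> x = x" using class_mult[OF pid_in x(1)] by (simp only: one x(2))
  show "\<exists>y\<in>carrier ?C. y \<otimes>\<^bsub>?C\<^esub> x = \<one>\<^bsub>?C\<^esub>"
  proof (rule bexI)
    let ?q = "(B, A, restrict (inv_into A f) B)"
    show "comm_class G ?q \<in> carrier ?C" by (intro class_in pinv_in x(1))
    have q: "pcomp ?q (A, B, f) \<in> fi_isos G" by (intro pcomp_in pinv_in x(1))
    have "comm_class G (pcomp ?q (A, B, f)) = \<one>\<^bsub>?C\<^esub>"
      unfolding one pcomp.simps Let_def
      by (rule class_eqI[OF q[unfolded pcomp.simps Let_def] pid_in d(1)])
        (use d(6,7) subgroup.subset[OF d(3)] in auto)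
    then show "comm_class G ?q \<otimes>\<^bsub>?C\<^esub> x = \<one>\<^bsub>?C\<^esub>"
      using class_mult[OF pinv_in[OF x(1)] x(1)] by (simp only: x(2))
  qed
  fix y assume "y \<in> carrier ?C"
  then obtain A' B' f' where y: "(A', B', f') \<in> fi_isos G" "y = comm_class G (A', B', f')" by (rule class_cases)
  show "x \<otimes>\<^bsub>?C\<^esub> y \<in> carrier ?C" 
    unfolding x(2) y(2) class_mult[OF x(1) y(1)] by (rule class_in[OF pcomp_in[OF x(1) y(1)]])
  fix z assume "z \<in> carrier ?C"
  then obtain A'' B'' f'' where z: "(A'', B'', f'') \<in> fi_isos G" "z = comm_class G (A'', B'', f'')" by (rule class_cases)
  note d' = fi_isosD[OF y(1)] and d'' = fi_isosD[OF z(1)]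
  have i: "pcomp (pcomp (A, B, f) (A', B', f')) (A'', B'', f'') \<in> fi_isos G"
       "pcomp (A, B, f) (pcomp (A', B', f') (A'', B'', f'')) \<in> fi_isos G"
    by (intro pcomp_in x(1) y(1) z(1))+
  have "finite_index {h \<in> A''. f'' h \<in> {h \<in> A'. f' h \<in> A}} G"
    by (rule fi_preimage[OF z(1) fi_preimage[OF y(1) d(1)]])
  then have "comm_class G (pcomp (pcomp (A, B, f) (A', B', f')) (A'', B'', f'')) =
        comm_class G (pcomp (A, B, f) (pcomp (A', B', f') (A'', B'', f'')))"
    unfolding pcomp.simps Let_def
    by (rule class_eqI[OF i[unfolded pcomp.simps Let_def]])
      (use d'(7) d''(7) in auto)
  then show "x \<otimes>\<^bsub>?C\<^esub> y \<otimes>\<^bsub>?C\<^esub> z = x \<otimes>\<^bsub>?C\<^esub> (y \<otimes>\<^bsub>?C\<^esub> z)"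
    by (simp only: x(2) y(2) z(2) class_mult[OF x(1) y(1)] class_mult[OF y(1) z(1)]
        class_mult[OF pcomp_in[OF x(1) y(1)] z(1)] class_mult[OF x(1) pcomp_in[OF y(1) z(1)]])
qed

lemma inv_cancel:
  assumes "g \<in> carrier G" "x \<in> carrier G"
  shows "inv g \<otimes> (g \<otimes> x) = x" "g \<otimes> (inv g \<otimes> x) = x"
  using assms by (simp_all add: m_assoc[symmetric])

lemma conj_set_iff:
  assumes H: "subgroup H G" and g: "g \<in> carrier G"
  shows "x \<in> conj_set G g H \<longleftrightarrow> x \<in> carrier G \<and> inv g \<otimes> x \<otimes> g \<in> H"
proof
  assume "x \<in> conj_set G g H"
  then obtain h where h: "h \<in> H" "x = g \<otimes> h \<otimes> inv g"
    by (auto simp: conj_set_def l_coset_def r_coset_def)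
  have "h \<in> carrier G" using h H subgroup.mem_carrier by metis
  then have "inv g \<otimes> x \<otimes> g = h" using h g by (simp add: m_assoc inv_cancel)
  then show "x \<in> carrier G \<and> inv g \<otimes> x \<otimes> g \<in> H" using h g \<open>h \<in> carrier G\<close> by simp
next
  assume x: "x \<in> carrier G \<and> inv g \<otimes> x \<otimes> g \<in> H"
  have "x = g \<otimes> (inv g \<otimes> x \<otimes> g) \<otimes> inv g" using x g
    by (simp add: m_assoc inv_mult_group inv_cancel)
  then show "x \<in> conj_set G g H" using x
    unfolding conj_set_def l_coset_def r_coset_def by blast
qed

lemma conj_set_subgroup:
  assumes H: "subgroup H G" and g: "g \<in> carrier G"
  shows "subgroup (H \<inter> conj_set G g H) (G\<lparr>carrier := H\<rparr>)"
proof (rule subgroup_incl[OF _ H])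
  note m = subgroup.mem_carrier[OF H]
  show "subgroup (H \<inter> conj_set G g H) G"
  proof (rule subgroup.intro)
    fix x y assume xy: "x \<in> H \<inter> conj_set G g H" "y \<in> H \<inter> conj_set G g H"
    then have c: "x \<in> carrier G" "y \<in> carrier G" "inv g \<otimes> x \<otimes> g \<in> H" "inv g \<otimes> y \<otimes> g \<in> H"
      by (auto simp: conj_set_iff[OF H g])
    have "inv g \<otimes> (x \<otimes> y) \<otimes> g = (inv g \<otimes> x \<otimes> g) \<otimes> (inv g \<otimes> y \<otimes> g)"
      using c(1,2) g by (simp add: m_assoc inv_mult_group inv_cancel)
    then have "inv g \<otimes> (x \<otimes> y) \<otimes> g \<in> H" using c subgroup.m_closed[OF H] by simp
    then show "x \<otimes> y \<in> H \<inter> conj_set G g H"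
      using xy c subgroup.m_closed[OF H] by (auto simp: conj_set_iff[OF H g])
  next
    fix x assume x: "x \<in> H \<inter> conj_set G g H"
    then have c: "x \<in> carrier G" "inv g \<otimes> x \<otimes> g \<in> H" by (auto simp: conj_set_iff[OF H g])
    have "inv g \<otimes> inv x \<otimes> g = inv (inv g \<otimes> x \<otimes> g)"
      using c(1) g by (simp add: inv_mult_group m_assoc)
    then have "inv g \<otimes> inv x \<otimes> g \<in> H" using c subgroup.m_inv_closed[OF H] by metis
    then show "inv x \<in> H \<inter> conj_set G g H"
      using x c subgroup.m_inv_closed[OF H] by (auto simp: conj_set_iff[OF H g])
  qed (use m g subgroup.one_closed[OF H] in \<open>auto simp: conj_set_iff[OF H g]\<close>)
next
  show "H \<inter> conj_set G g H \<subseteq> H" by simp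
qed

lemma conj_iso_in:
  assumes H: "subgroup H G" and g: "g \<in> commensurator G H"
  shows "conj_iso G H g \<in> fi_isos (G\<lparr>carrier := H\<rparr>)"
proof -
  interpret K: group "G\<lparr>carrier := H\<rparr>" by (rule subgroup_imp_group[OF H])
  have gc: "g \<in> carrier G" using g by (simp add: commensurator_def)
  note m = subgroup.mem_carrier[OF H] and i = conj_set_iff[OF H]
  let ?A = "H \<inter> conj_set G (inv g) H" and ?B = "H \<inter> conj_set G g H"
  show ?thesis unfolding conj_iso_def
  proof (rule K.fi_isosI)
    show "finite_index ?A (G\<lparr>carrier := H\<rparr>)" "finite_index ?B (G\<lparr>carrier := H\<rparr>)"
      using g by (auto simp: commensurator_def)
    have e: "inv g \<otimes> (g \<otimes> x \<otimes> inv g) \<otimes> g = x" "g \<otimes> (inv g \<otimes> x \<otimes> g) \<otimes> inv g = x" if "x \<in> carrier G" for x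
      using that gc by (simp_all add: m_assoc inv_mult_group inv_cancel)
    have "bij_betw (\<lambda>h. g \<otimes> h \<otimes> inv g) ?A ?B"
      by (rule bij_betw_byWitness[where f' = "\<lambda>h. inv g \<otimes> h \<otimes> g"])
        (use gc m e in \<open>auto simp: i\<close>)
    then show "bij_betw (restrict (\<lambda>h. g \<otimes> h \<otimes> inv g) ?A) ?A ?B" by simp
    fix x y assume xy: "x \<in> ?A" "y \<in> ?A"
    then have "x \<otimes> y \<in> ?A" using subgroup.m_closed[OF conj_set_subgroup[OF H, of "inv g"]] gc by simp
    moreover have "g \<otimes> (x \<otimes> y) \<otimes> inv g = (g \<otimes> x \<otimes> inv g) \<otimes> (g \<otimes> y \<otimes> inv g)"
      using xy m gc by (simp add: m_assoc inv_mult_group inv_cancel)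
    ultimately show "restrict (\<lambda>h. g \<otimes> h \<otimes> inv g) ?A (x \<otimes>\<^bsub>G\<lparr>carrier := H\<rparr>\<^esub> y) =
       restrict (\<lambda>h. g \<otimes> h \<otimes> inv g) ?A x \<otimes>\<^bsub>G\<lparr>carrier := H\<rparr>\<^esub> restrict (\<lambda>h. g \<otimes> h \<otimes> inv g) ?A y"
      using xy by simp
  qed simp
qed

lemma commensurator_mult:
  assumes H: "subgroup H G" and g: "g \<in> commensurator G H" and k: "k \<in> commensurator G H"
  shows "g \<otimes> k \<in> commensurator G H"
    and "canonical_map G H (g \<otimes> k) =
      canonical_map G H g \<otimes>\<^bsub>abstract_commensurator (G\<lparr>carrier := H\<rparr>)\<^esub> canonical_map G H k"
proof -
  let ?K = "G\<lparr>carrier := H\<rparr>"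
  interpret K: group ?K by (rule subgroup_imp_group[OF H])
  have gc: "g \<in> carrier G" "k \<in> carrier G" using g k by (simp_all add: commensurator_def)
  note m = subgroup.mem_carrier[OF H] and i = conj_set_iff[OF H]
  note gi = conj_iso_in[OF H g] and ki = conj_iso_in[OF H k]
  have p: "pcomp (conj_iso G H g) (conj_iso G H k) \<in> fi_isos ?K" using K.pcomp_in gi ki by blast
  then obtain D E f where def: "pcomp (conj_iso G H g) (conj_iso G H k) = (D, E, f)" and pi: "(D, E, f) \<in> fi_isos ?K"
    by (metis prod_cases3)
  note d = K.fi_isosD[OF pi]
  have conj: "g \<otimes> (k \<otimes> x \<otimes> inv k) \<otimes> inv g = (g \<otimes> k) \<otimes> x \<otimes> inv (g \<otimes> k)" if "x \<in> carrier G" for x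
    using that gc by (simp add: m_assoc inv_mult_group)
  have D: "D = {h \<in> H \<inter> conj_set G (inv k) H. k \<otimes> h \<otimes> inv k \<in> (H \<inter> conj_set G (inv g) H) \<inter> (H \<inter> conj_set G k H)}"
    using def by (auto simp: conj_iso_def Let_def)
  have fD: "f x = (g \<otimes> k) \<otimes> x \<otimes> inv (g \<otimes> k)" if x: "x \<in> D" for x
  proof -
    have "f x = g \<otimes> (k \<otimes> x \<otimes> inv k) \<otimes> inv g"
      using def x unfolding D by (auto simp: conj_iso_def Let_def)
    then show ?thesis using conj x m unfolding D by auto
  qed
  have EH: "E \<subseteq> H" "D \<subseteq> H" using d(3,4) subgroup.subset by force+
  have DA: "D \<subseteq> H \<inter> conj_set G (inv (g \<otimes> k)) H"
  proof
    fix x assume x: "x \<in> D"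
    then show "x \<in> H \<inter> conj_set G (inv (g \<otimes> k)) H"
      using fD[OF x] d(7)[OF x] EH m gc by (auto simp: i)
  qed
  have EB: "E \<subseteq> H \<inter> conj_set G (g \<otimes> k) H"
  proof
    fix y assume y: "y \<in> E"
    then obtain x where x: "x \<in> D" "y = f x" using d(5) by blast
    have xc: "x \<in> carrier G" "x \<in> H" using x EH m by auto
    have "inv (g \<otimes> k) \<otimes> y \<otimes> (g \<otimes> k) = x"
      using x fD[OF x(1)] xc gc by (simp add: m_assoc inv_mult_group inv_cancel)
    then show "y \<in> H \<inter> conj_set G (g \<otimes> k) H" using y EH m gc xc by (auto simp: i)
  qed
  have "finite_index (H \<inter> conj_set G (inv (g \<otimes> k)) H) ?K" "finite_index (H \<inter> conj_set G (g \<otimes> k) H) ?K"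
    using K.finite_index_mono[OF d(1) conj_set_subgroup[OF H] DA]
      K.finite_index_mono[OF d(2) conj_set_subgroup[OF H] EB] gc by auto
  then show gk: "g \<otimes> k \<in> commensurator G H" using gc by (simp add: commensurator_def)
  have "comm_class ?K (conj_iso G H (g \<otimes> k)) = comm_class ?K (D, E, f)"
    using conj_iso_in[OF H gk] pi d(1) unfolding conj_iso_def
    by (rule K.class_eqI) (use DA fD in auto)
  then show "canonical_map G H (g \<otimes> k) =
      canonical_map G H g \<otimes>\<^bsub>abstract_commensurator ?K\<^esub> canonical_map G H k"
    using gi ki def by (simp add: canonical_map_def K.class_mult)
qed

theorem commensurator_subgroup:
  assumes H: "subgroup H G" shows "subgroup (commensurator G H) G"
proof (rule subgroup.intro)
  show "commensurator G H \<subseteq> carrier G" by (auto simp: commensurator_def)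
  show "x \<otimes> y \<in> commensurator G H" if "x \<in> commensurator G H" "y \<in> commensurator G H" for x y
    using commensurator_mult(1)[OF H] that .
  show "inv x \<in> commensurator G H" if "x \<in> commensurator G H" for x
    using that by (auto simp: commensurator_def)
  interpret K: group "G\<lparr>carrier := H\<rparr>" by (rule subgroup_imp_group[OF H])
  have "H \<inter> conj_set G \<one> H = H" using subgroup.mem_carrier[OF H] by (auto simp: conj_set_iff[OF H])
  then show "\<one> \<in> commensurator G H"
    using K.finite_index_carrier by (simp add: commensurator_def)
qed

theorem canonical_map_hom:
  assumes H: "subgroup H G"
  shows "canonical_map G H \<in> hom (G\<lparr>carrier := commensurator G H\<rparr>) (abstract_commensurator (G\<lparr>carrier := H\<rparr>))"
proof -
  interpret K: group "G\<lparr>carrier := H\<rparr>" by (rule subgroup_imp_group[OF H])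
  show ?thesis
    using commensurator_mult(2)[OF H] K.class_in conj_iso_in[OF H]
    by (auto simp: hom_def canonical_map_def)
qed

end

end

theory Submission
  imports Defs "HOL-Algebra.FiniteProduct"
begin

text \<open>Write \<open>H \<otimes> \<rat>\<close> for the rational vector space of the finitely generated abelian group \<open>H\<close>. Conjugation by
an element \<open>g\<close> of the commensurator carries a finite-index subgroup of \<open>H\<close> to another one, so it acts
linearly on \<open>H \<otimes> \<rat>\<close>, and the class of \<open>g\<close> in the abstract commensurator is determined by this linear
map. The proof exhibits a finite spanning set of points of \<open>H \<otimes> \<rat>\<close> that every \<open>g\<close> permutes: the
vertices of a polytope that depends only on \<open>H\<close> and the biautomatic structure.

The polytope comes from the stable length of \<open>h \<in> H\<close>, the growth rate in \<open>k\<close> of the length of a shortest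
accepted word for \<open>h\<^sup>k\<close>. The two-sided fellow traveller property, combined with cutting cycles out of the
automaton, shows that multiplying an element on both sides by fixed elements changes this length by a
bounded amount (\<open>translation_length_bound\<close>); hence stable length is invariant under conjugation. The
polytope is the convex hull of the points \<open>h / l\<close> with \<open>h\<close> of stable length at most \<open>l\<close>.

It is a polytope with rational vertices for the following reason. Fellow travelling implies that prefixes
of accepted words for elements of a centraliser of a finite set lie in finitely many cosets of the
centraliser. Applying this twice yields an abelian group \<open>A\<close>, the double centraliser of \<open>H\<close>, that contains
\<open>H\<close> and has the same property (\<open>abelian_overgroup\<close>). The pairs (automaton state, coset of \<open>A\<close>) are then
the vertices of a finite graph in which the accepted words with value in \<open>A\<close> are paths. A loop of this
graph has a value in \<open>A\<close>; as \<open>A\<close> is abelian, erasing a loop from a path divides the value by that of the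
loop and subtracts the length of the loop from the length (\<open>loop_erasure\<close>), and inserting loops does the
opposite (\<open>pump\<close>). So, up to bounded errors, the pairs (value, length) form finitely generated monoids,
one for each set of visited vertices. Intersecting them with \<open>H \<times> \<nat>\<close> leaves finitely generated monoids, by
Gordan's lemma (\<open>gordan\<close>), and their generators \<open>(u, l)\<close> yield finitely many points \<open>u / l\<close> whose convex
hull is the required polytope (\<open>stable_length_cone\<close>).

In the formal text a pair \<open>(w, l)\<close> stands for the point \<open>w / l\<close>, and
\<open>in_cone\<close> says that a point is a convex combination of given points and the origin, after clearing
denominators and up to torsion. Limits are replaced by Dickson's lemma (\<open>in_cone_of_linear_growth\<close>). A
minimal set of points with the same hull is the set of vertices (\<open>irredundant_subset\<close>, \<open>irredundant_face\<close>),
and an element of the commensurator permutes it, because both it and its inverse preserve the hull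
(\<open>commensurator_permutes_extremal\<close>). Finally, two elements inducing the same permutation agree on powers
of all vertices, hence on a subgroup with finitely generated torsion quotient, which has finite index
(\<open>finite_image_canonical_map\<close>). The kernel of the canonical map is the normal subgroup of the second claim.\<close>

section \<open>Finiteness and divisibility of exponents\<close>

text \<open>On \<open>P\<close>, the map \<open>h\<close> factors through \<open>f\<close>.\<close>

lemma finite_image_if_determined:
  assumes "finite (f ` P)" "\<And>x y. x \<in> P \<Longrightarrow> y \<in> P \<Longrightarrow> f x = f y \<Longrightarrow> h x = h y"
  shows "finite (h ` P)"
proof -
  have "h x = h (inv_into P f (f x))" if "x \<in> P" for x
    using assms(2)[OF that inv_into_into[of "f x" f P]] that by (simp add: f_inv_into_f)
  then have "h ` P \<subseteq> (\<lambda>z. h (inv_into P f z)) ` f ` P" by auto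
  then show ?thesis using assms(1) finite_surj by blast
qed

text \<open>Dickson's lemma. In the induction step, a vector that is large in the new coordinate dominates an
element of a basis for the other coordinates, and the vectors that are small there fall into finitely
many slices, each of which has its own finite basis.\<close>

lemma dickson:
  fixes T :: "('i \<Rightarrow> nat) set"
  assumes "finite J"
  shows "\<exists>B\<subseteq>T. finite B \<and> (\<forall>d\<in>T. \<exists>b\<in>B. \<forall>j\<in>J. b j \<le> d j)"
  using assms
proof (induction J arbitrary: T rule: finite_induct)
  case empty
  show ?case
  proof (cases "T = {}")
    case False
    then obtain t where "t \<in> T" by blast
    then show ?thesis by (intro exI[of _ "{t}"]) auto
  qed auto
next
  case (insert i J)
  obtain B0 where B0: "B0 \<subseteq> T" "finite B0" "\<forall>d\<in>T. \<exists>b\<in>B0. \<forall>j\<in>J. b j \<le> d j"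
    using insert.IH[of T] by metis
  have "finite ((\<lambda>b. b i) ` B0)" using B0(2) by simp
  then obtain m where m: "\<forall>b\<in>B0. b i \<le> m"
    unfolding finite_nat_set_iff_bounded_le by auto
  have "\<forall>n. \<exists>B\<subseteq>{d \<in> T. d i = n}. finite B \<and> (\<forall>d\<in>{d \<in> T. d i = n}. \<exists>b\<in>B. \<forall>j\<in>J. b j \<le> d j)"
    by (intro allI insert.IH)
  then obtain B where "\<forall>n. B n \<subseteq> {d \<in> T. d i = n} \<and> finite (B n) \<and>
      (\<forall>d\<in>{d \<in> T. d i = n}. \<exists>b\<in>B n. \<forall>j\<in>J. b j \<le> d j)"
    unfolding choice_iff by blast
  then have B: "\<And>n. B n \<subseteq> {d \<in> T. d i = n}" "\<And>n. finite (B n)"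
    "\<And>n d. d \<in> T \<Longrightarrow> d i = n \<Longrightarrow> \<exists>b\<in>B n. \<forall>j\<in>J. b j \<le> d j"
    by simp_all
  show ?case
  proof (intro exI[of _ "B0 \<union> (\<Union>n<m. B n)"] conjI ballI)
    show "B0 \<union> (\<Union>n<m. B n) \<subseteq> T" using B0(1) B(1) by blast
    show "finite (B0 \<union> (\<Union>n<m. B n))" using B0(2) B(2) by simp
    fix d assume d: "d \<in> T"
    show "\<exists>b\<in>B0 \<union> (\<Union>n<m. B n). \<forall>j\<in>insert i J. b j \<le> d j"
    proof (cases "d i < m")
      case True
      obtain b where b: "b \<in> B (d i)" "\<forall>j\<in>J. b j \<le> d j" using B(3)[OF d] by blast
      moreover have "b i = d i" using b(1) B(1) by blast
      ultimately show ?thesis using True by (intro bexI[of _ b]) auto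
    next
      case False
      obtain b where b: "b \<in> B0" "\<forall>j\<in>J. b j \<le> d j" using B0(3) d by blast
      moreover have "b i \<le> d i" using False m b(1) by fastforce
      ultimately show ?thesis by (intro bexI[of _ b]) auto
    qed
  qed
qed

lemma common_multiple:
  fixes P :: "'s \<Rightarrow> nat \<Rightarrow> bool"
  assumes "finite S" "\<And>s. s \<in> S \<Longrightarrow> \<exists>k>0. P s k"
    and mult: "\<And>s k m. s \<in> S \<Longrightarrow> P s k \<Longrightarrow> m > 0 \<Longrightarrow> P s (k * m)"
  shows "\<exists>k>0. \<forall>s\<in>S. P s k"
  using assms
proof (induction S rule: finite_induct)
  case (insert s S)
  obtain k where k: "k > 0" "\<forall>s\<in>S. P s k" using insert by (metis insertCI)
  obtain m where m: "m > 0" "P s m" using insert by (metis insertCI)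
  have "P t (k * m)" if "t \<in> insert s S" for t
  proof (cases "t = s")
    case True
    then show ?thesis using insert.prems(2)[OF that, of m k] m k by (simp add: mult.commute)
  next
    case False
    then show ?thesis using insert.prems(2)[OF that, of k m] that m k by simp
  qed
  then show ?case using k m by (intro exI[of _ "k * m"]) auto
qed auto

section \<open>Points with weights in an abelian group\<close>

text \<open>A pair \<open>(w, l)\<close> with \<open>l > 0\<close> represents the point \<open>w / l\<close> of the rational vector space of an abelian group. The
products of elements of \<open>W\<close>, with added weights, represent the multiples of convex combinations; the
slack in the weight of \<open>\<one>\<close> makes the origin an additional point.\<close>

inductive_set weighted_products ::
  "('a, 'b) monoid_scheme \<Rightarrow> ('a \<times> nat) set \<Rightarrow> ('a \<times> nat) set" for K W where
  slack: "(\<one>\<^bsub>K\<^esub>, n) \<in> weighted_products K W"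
| factor: "(x, n) \<in> weighted_products K W \<Longrightarrow> (w, l) \<in> W \<Longrightarrow>
    (w \<otimes>\<^bsub>K\<^esub> x, l + n) \<in> weighted_products K W"

text \<open>The point \<open>x / l\<close> lies in the convex hull of the origin and of the points of \<open>W\<close>: the power \<open>k\<close> clears
denominators and kills torsion.\<close>

definition in_cone :: "('a, 'b) monoid_scheme \<Rightarrow> ('a \<times> nat) set \<Rightarrow> 'a \<Rightarrow> nat \<Rightarrow> bool" where
  "in_cone K W x l \<longleftrightarrow> (\<exists>k>0. (x [^]\<^bsub>K\<^esub> (k::nat), k * l) \<in> weighted_products K W)"

text \<open>The generator \<open>j\<close> occurs with exponent \<open>d j\<close>; in this form Dickson's lemma applies to weighted products.\<close>

definition monomial :: "('a, 'b) monoid_scheme \<Rightarrow> ('a \<times> nat) set \<Rightarrow> ('a \<times> nat \<Rightarrow> nat) \<Rightarrow> 'a" where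
  "monomial K J d = finprod K (\<lambda>j. fst j [^]\<^bsub>K\<^esub> d j) J"

definition weight :: "('a \<times> nat) set \<Rightarrow> ('a \<times> nat \<Rightarrow> nat) \<Rightarrow> nat" where
  "weight J d = (\<Sum>j\<in>J. d j * snd j)"

lemma weighted_products_mono:
  assumes "(x, n) \<in> weighted_products K W" "W \<subseteq> W'"
  shows "(x, n) \<in> weighted_products K W'"
  using assms(1)
  by (induction rule: weighted_products.induct) (use assms(2) in \<open>auto intro: weighted_products.intros\<close>)

lemma weighted_products_carrier_update:
  "weighted_products (K\<lparr>carrier := A\<rparr>) W = weighted_products K W"
proof -
  have "(x, n) \<in> weighted_products K W" if "(x, n) \<in> weighted_products (K\<lparr>carrier := A\<rparr>) W" for x n
    using that by (induction rule: weighted_products.induct) (simp_all add: weighted_products.intros)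
  moreover have "(x, n) \<in> weighted_products (K\<lparr>carrier := A\<rparr>) W" if "(x, n) \<in> weighted_products K W" for x n
    using that
  proof (induction rule: weighted_products.induct)
    case (slack n)
    show ?case using weighted_products.slack[of "K\<lparr>carrier := A\<rparr>" n W] by simp
  next
    case (factor x n w l)
    then show ?case using weighted_products.factor[of x n "K\<lparr>carrier := A\<rparr>" W w l] by simp
  qed
  ultimately show ?thesis by auto
qed

lemma in_cone_carrier_update: "in_cone (K\<lparr>carrier := A\<rparr>) W x l = in_cone K W x l"
  by (simp add: in_cone_def weighted_products_carrier_update nat_pow_def)

context comm_group begin

lemma weighted_products_closed:
  assumes "W \<subseteq> carrier G \<times> UNIV" "(x, n) \<in> weighted_products G W"
  shows "x \<in> carrier G"
  using assms(2)
  by (induction rule: weighted_products.induct) (use assms(1) in auto)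

lemma weighted_products_generator:
  assumes "W \<subseteq> carrier G \<times> UNIV" "(w, l) \<in> W"
  shows "(w, l) \<in> weighted_products G W"
  using weighted_products.factor[OF weighted_products.slack[of G 0 W] assms(2)] assms by auto

lemma weighted_products_mult:
  assumes W: "W \<subseteq> carrier G \<times> UNIV"
    and x: "(x, n) \<in> weighted_products G W" and y: "(y, m) \<in> weighted_products G W"
  shows "(x \<otimes> y, n + m) \<in> weighted_products G W"
  using x
proof (induction rule: weighted_products.induct)
  case (slack n)
  show ?case using y
  proof (induction rule: weighted_products.induct)
    case (slack m)
    show ?case using weighted_products.slack[of G "n + m" W] by simp
  next
    case (factor x m w l)
    have "(w \<otimes> (\<one> \<otimes> x), l + (n + m)) \<in> weighted_products G W"
      by (rule weighted_products.factor[OF factor(3,2)])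
    then show ?case using W factor weighted_products_closed[OF W factor(1)]
      by (auto simp: algebra_simps)
  qed
next
  case (factor x n w l)
  have "(w \<otimes> (x \<otimes> y), l + (n + m)) \<in> weighted_products G W"
    by (rule weighted_products.factor[OF factor(3,2)])
  then show ?case
    using W factor(2) weighted_products_closed[OF W factor(1)] weighted_products_closed[OF W y]
    by (auto simp: algebra_simps m_assoc)
qed

lemma weighted_products_pow:
  assumes "W \<subseteq> carrier G \<times> UNIV" "(x, n) \<in> weighted_products G W"
  shows "(x [^] (k::nat), k * n) \<in> weighted_products G W"
proof (induction k)
  case 0
  show ?case using weighted_products.slack[of G 0 W] by simp
next
  case (Suc k)
  show ?case using weighted_products_mult[OF assms(1) Suc assms(2)] by (simp add: algebra_simps)
qed

text \<open>Convex combinations of points of a convex hull stay in it, in the form with one common denominator \<open>k\<close>.\<close>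

lemma weighted_products_pow_trans:
  assumes W: "W \<subseteq> carrier G \<times> UNIV" and W': "W' \<subseteq> carrier G \<times> UNIV"
    and k: "\<And>w l. (w, l) \<in> W' \<Longrightarrow> (w [^] (k::nat), k * l) \<in> weighted_products G W"
    and x: "(x, n) \<in> weighted_products G W'"
  shows "(x [^] k, k * n) \<in> weighted_products G W"
  using x
proof (induction rule: weighted_products.induct)
  case (slack n)
  show ?case using weighted_products.slack[of G "k * n" W] by simp
next
  case (factor x n w l)
  have "x \<in> carrier G" "w \<in> carrier G"
    using factor W' weighted_products_closed[OF W'] by auto
  then show ?case using weighted_products_mult[OF W k[OF factor(2)] factor(3)]
    by (simp add: nat_pow_distrib algebra_simps)
qed

text \<open>Isolates the contribution of one generator; in an abelian group its occurrences can be collected.\<close>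

lemma weighted_products_split:
  assumes W: "W \<subseteq> carrier G \<times> UNIV" and w: "w \<in> carrier G"
    and x: "(x, n) \<in> weighted_products G W"
  shows "\<exists>i y m. (y, m) \<in> weighted_products G (W - {(w, l)}) \<and>
    x = w [^] (i::nat) \<otimes> y \<and> n = i * l + m"
  using x
proof (induction rule: weighted_products.induct)
  case (slack n)
  show ?case
    by (intro exI[of _ 0] exI[of _ \<one>] exI[of _ n]) (auto intro: weighted_products.slack)
next
  case (factor x n v l')
  have W': "W - {(w, l)} \<subseteq> carrier G \<times> UNIV" using W by auto
  obtain i y m where y: "(y, m) \<in> weighted_products G (W - {(w, l)})"
    "x = w [^] (i::nat) \<otimes> y" "n = i * l + m" using factor by blast
  have c: "y \<in> carrier G" "v \<in> carrier G"
    using weighted_products_closed[OF W' y(1)] factor(2) W by auto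
  show ?case
  proof (cases "(v, l') = (w, l)")
    case True
    then have "v \<otimes> x = w [^] Suc i \<otimes> y"
      using y w c by (simp add: m_ac)
    then show ?thesis using y True
      by (intro exI[of _ "Suc i"] exI[of _ y] exI[of _ m]) auto
  next
    case False
    then have "(v \<otimes> y, l' + m) \<in> weighted_products G (W - {(w, l)})"
      using y factor(2) by (intro weighted_products.factor) auto
    moreover have "v \<otimes> x = w [^] i \<otimes> (v \<otimes> y)" using y w c by (simp add: m_ac)
    ultimately show ?thesis using y by fastforce
  qed
qed

lemma weighted_products_weight_0:
  assumes "(x, 0) \<in> weighted_products G W" "W \<subseteq> carrier G \<times> {0<..}"
  shows "x = \<one>"
  using assms(1) by (cases rule: weighted_products.cases) (use assms(2) in auto)

lemma in_cone_trans:
  assumes W: "W \<subseteq> carrier G \<times> UNIV" and V: "finite V" "V \<subseteq> carrier G \<times> UNIV"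
    and VW: "\<And>v m. (v, m) \<in> V \<Longrightarrow> in_cone G W v m"
    and x: "x \<in> carrier G" "in_cone G V x l"
  shows "in_cone G W x l"
proof -
  have "\<exists>k>0. \<forall>p\<in>V. (fst p [^] (k::nat), k * snd p) \<in> weighted_products G W"
  proof (rule common_multiple[OF V(1)])
    show "\<exists>k>0. (fst p [^] (k::nat), k * snd p) \<in> weighted_products G W" if "p \<in> V" for p
      using VW[of "fst p" "snd p"] that by (simp add: in_cone_def)
    show "(fst p [^] (k * j), k * j * snd p) \<in> weighted_products G W"
      if "p \<in> V" "(fst p [^] k, k * snd p) \<in> weighted_products G W" for p and k j :: nat
    proof -
      have "fst p \<in> carrier G" using that(1) V(2) by auto
      then show ?thesis
        using weighted_products_pow[OF W that(2), of j] by (simp add: nat_pow_pow mult_ac)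
    qed
  qed
  then obtain k where k0: "k > 0" "\<forall>p\<in>V. (fst p [^] (k::nat), k * snd p) \<in> weighted_products G W"
    by blast
  have k: "(v [^] k, k * m) \<in> weighted_products G W" if "(v, m) \<in> V" for v m
    using bspec[OF k0(2) that] by simp
  obtain j where j: "j > 0" "(x [^] (j::nat), j * l) \<in> weighted_products G V"
    using x(2) unfolding in_cone_def by blast
  have "((x [^] j) [^] k, k * (j * l)) \<in> weighted_products G W"
    by (rule weighted_products_pow_trans[OF W V(2) k j(2)])
  then have "(x [^] (j * k), (j * k) * l) \<in> weighted_products G W"
    using x(1) by (simp add: nat_pow_pow mult_ac)
  then show ?thesis unfolding in_cone_def using j(1) k0(1) by (intro exI[of _ "j * k"]) auto
qed

lemma in_cone_generator:
  assumes "W \<subseteq> carrier G \<times> UNIV" "(w, l) \<in> W"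
  shows "in_cone G W w l"
  unfolding in_cone_def using weighted_products_generator[OF assms] assms
  by (intro exI[of _ "1::nat"]) auto

text \<open>A set of least cardinality among the subsets of \<open>E\<close> with the same convex hull consists of the vertices of
the hull: a member in the hull of the others could be dropped.\<close>

lemma irredundant_subset:
  assumes E: "finite E" "E \<subseteq> carrier G \<times> UNIV"
  shows "\<exists>W\<subseteq>E. (\<forall>(u, l)\<in>E. in_cone G W u l) \<and> (\<forall>(w, l)\<in>W. \<not> in_cone G (W - {(w, l)}) w l)"
proof -
  define P where "P W \<longleftrightarrow> W \<subseteq> E \<and> (\<forall>(u, l)\<in>E. in_cone G W u l)" for W
  have "P E" unfolding P_def using in_cone_generator[OF E(2)] by auto
  then obtain W where W: "P W" "\<And>V. P V \<Longrightarrow> card W \<le> card V"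
    using ex_has_least_nat[of P E card] by blast
  have fW: "finite W" "W \<subseteq> carrier G \<times> UNIV" using W(1) E finite_subset unfolding P_def by blast+
  have "\<not> in_cone G (W - {(w, l)}) w l" if w: "(w, l) \<in> W" for w l
  proof
    let ?V = "W - {(w, l)}"
    have V: "?V \<subseteq> carrier G \<times> UNIV" using fW by auto
    assume "in_cone G ?V w l"
    then have V_cone: "in_cone G ?V v m" if "(v, m) \<in> W" for v m
      using in_cone_generator[OF V] that by (cases "(v, m) = (w, l)") auto
    have "in_cone G ?V u m" if "(u, m) \<in> E" for u m
    proof (rule in_cone_trans[OF V fW])
      show "u \<in> carrier G" "in_cone G W u m" using that W(1) E(2) unfolding P_def by auto
    qed (rule V_cone)
    then have "P ?V" using W(1) unfolding P_def by auto
    then show False using W(2)[of ?V] card_Diff1_less[OF fW(1) w] by simp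
  qed
  then show ?thesis using W(1) unfolding P_def by blast
qed

text \<open>A vertex of a convex hull is an extreme point: if a convex combination of \<open>x\<close> and \<open>y\<close> equals the vertex
\<open>w / l\<close>, then both summands are multiples of \<open>w / l\<close>. Otherwise the remaining generators would already
produce a multiple of \<open>w / l\<close>, against irredundancy.\<close>

lemma irredundant_face:
  assumes W: "W \<subseteq> carrier G \<times> {0<..}"
    and irr: "\<not> in_cone G (W - {(w, l)}) w l" and w: "(w, l) \<in> W"
    and x: "(x, n) \<in> weighted_products G W" and y: "(y, m) \<in> weighted_products G W"
    and xy: "x \<otimes> y = w [^] (k::nat)" "n + m = k * l"
  shows "\<exists>i. x = w [^] (i::nat) \<and> n = i * l"
proof -
  have W1: "W \<subseteq> carrier G \<times> UNIV" and W2: "W - {(w, l)} \<subseteq> carrier G \<times> UNIV"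
    and W3: "W - {(w, l)} \<subseteq> carrier G \<times> {0<..}"
    and wc: "w \<in> carrier G" and l: "l > 0" using W w by auto
  obtain i x' n' where x': "(x', n') \<in> weighted_products G (W - {(w, l)})"
    "x = w [^] (i::nat) \<otimes> x'" "n = i * l + n'" using weighted_products_split[OF W1 wc x] by blast
  obtain j y' m' where y': "(y', m') \<in> weighted_products G (W - {(w, l)})"
    "y = w [^] (j::nat) \<otimes> y'" "m = j * l + m'" using weighted_products_split[OF W1 wc y] by blast
  have c: "x' \<in> carrier G" "y' \<in> carrier G" using weighted_products_closed[OF W2] x'(1) y'(1) by blast+
  have e: "w [^] k = w [^] (i + j) \<otimes> (x' \<otimes> y')"
    using xy(1) x' y' c wc by (simp add: m_ac nat_pow_mult[symmetric])
  have e2: "k * l = (i + j) * l + (n' + m')" using xy(2) x' y' by (simp add: algebra_simps)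
  have "k \<le> i + j"
  proof (rule ccontr)
    assume "\<not> k \<le> i + j"
    then obtain r where r: "k = (i + j) + r" "r > 0" by (metis less_imp_add_positive not_le)
    have "w [^] (i + j) \<otimes> w [^] r = w [^] (i + j) \<otimes> (x' \<otimes> y')"
      using e r wc by (simp add: nat_pow_mult)
    then have "w [^] r = x' \<otimes> y'" using c wc by simp
    moreover have "r * l = n' + m'" using e2 r by (simp add: algebra_simps)
    ultimately have "in_cone G (W - {(w, l)}) w l"
      unfolding in_cone_def using weighted_products_mult[OF W2 x'(1) y'(1)] r(2) by (intro exI[of _ r]) simp
    then show False using irr by simp
  qed
  then have "k * l \<le> (i + j) * l" by simp
  then have "n' = 0" using e2 by simp
  then have "x' = \<one>" using weighted_products_weight_0[OF _ W3] x'(1) by simp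
  then show ?thesis using x' \<open>n' = 0\<close> wc by auto
qed

lemma monomial_closed:
  assumes "J \<subseteq> carrier G \<times> UNIV"
  shows "monomial G J d \<in> carrier G"
  unfolding monomial_def using assms by (intro finprod_closed) auto

lemma monomial_add:
  assumes "J \<subseteq> carrier G \<times> UNIV"
  shows "monomial G J (\<lambda>j. d j + e j) = monomial G J d \<otimes> monomial G J e"
proof -
  have "monomial G J (\<lambda>j. d j + e j) = finprod G (\<lambda>j. fst j [^] d j \<otimes> fst j [^] e j) J"
    unfolding monomial_def by (rule finprod_cong') (use assms in \<open>auto simp: nat_pow_mult\<close>)
  also have "\<dots> = monomial G J d \<otimes> monomial G J e"
    unfolding monomial_def by (rule finprod_multf) (use assms in auto)
  finally show ?thesis .
qed

lemma weight_add: "weight J (\<lambda>j. d j + e j) = weight J d + weight J e"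
  by (simp add: weight_def sum.distrib algebra_simps)

lemma monomial_cong:
  assumes "J \<subseteq> carrier G \<times> UNIV" "\<And>j. j \<in> J \<Longrightarrow> d j = e j"
  shows "monomial G J d = monomial G J e" "weight J d = weight J e"
proof -
  show "monomial G J d = monomial G J e"
    unfolding monomial_def by (rule finprod_cong') (use assms in auto)
  show "weight J d = weight J e" using assms(2) by (simp add: weight_def)
qed

lemma monomial_diff:
  assumes "J \<subseteq> carrier G \<times> UNIV" "\<And>j. j \<in> J \<Longrightarrow> b j \<le> d j"
  shows "monomial G J d = monomial G J b \<otimes> monomial G J (\<lambda>j. d j - b j)"
    "weight J d = weight J b + weight J (\<lambda>j. d j - b j)"
  using monomial_add[OF assms(1), of b "\<lambda>j. d j - b j"] weight_add[of J b "\<lambda>j. d j - b j"]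
    monomial_cong[OF assms(1), of d "\<lambda>j. b j + (d j - b j)"] assms(2) by auto

lemma monomial_single:
  assumes J: "finite J" "J \<subseteq> carrier G \<times> UNIV" and j: "j \<in> J"
  shows "monomial G J (\<lambda>i. if i = j then k else 0) = fst j [^] k"
    "weight J (\<lambda>i. if i = j then k else 0) = k * snd j"
proof -
  have "monomial G J (\<lambda>i. if i = j then k else 0) = (\<Otimes>i\<in>J. if j = i then fst i [^] k else \<one>)"
    unfolding monomial_def by (rule finprod_cong') (use J in auto)
  also have "\<dots> = fst j [^] k" by (rule finprod_singleton) (use J j in auto)
  finally show "monomial G J (\<lambda>i. if i = j then k else 0) = fst j [^] k" .
  have "(\<Sum>i\<in>J. (if i = j then k else 0) * snd i) = (\<Sum>i\<in>J. if i = j then k * snd i else 0)"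
    by (rule sum.cong) auto
  then show "weight J (\<lambda>i. if i = j then k else 0) = k * snd j"
    using J j by (simp add: weight_def)
qed

lemma monomial_in_weighted_products:
  assumes "finite W" "W \<subseteq> carrier G \<times> UNIV"
  shows "(monomial G (insert (\<one>, 1) W) d, weight (insert (\<one>, 1) W) d) \<in> weighted_products G W"
proof -
  let ?J = "insert (\<one>, 1) W"
  have "finite F \<Longrightarrow> F \<subseteq> ?J \<Longrightarrow> (monomial G F d, weight F d) \<in> weighted_products G W" for F
  proof (induction F rule: finite_induct)
    case empty
    show ?case using weighted_products.slack[of G 0 W] by (simp add: monomial_def weight_def)
  next
    case (insert j F)
    have "(fst j, snd j) \<in> weighted_products G W"
    proof (cases "j \<in> W")
      case True
      then show ?thesis using weighted_products_generator[OF assms(2), of "fst j" "snd j"] by simp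
    next
      case False
      then show ?thesis using insert.prems weighted_products.slack by auto
    qed
    then have "(fst j [^] d j, d j * snd j) \<in> weighted_products G W"
      by (rule weighted_products_pow[OF assms(2)])
    from weighted_products_mult[OF assms(2) this] insert
    have "(fst j [^] d j \<otimes> monomial G F d, d j * snd j + weight F d) \<in> weighted_products G W" by blast
    moreover have "monomial G (insert j F) d = fst j [^] d j \<otimes> monomial G F d"
    proof -
      have "insert j F \<subseteq> carrier G \<times> UNIV" using insert(4) assms(2) by auto
      then show ?thesis
        unfolding monomial_def using insert(1,2) by (intro finprod_insert) auto
    qed
    ultimately show ?case using insert by (simp add: weight_def)
  qed
  then show ?thesis using assms by simp
qed

text \<open>Including \<open>(\<one>, 1)\<close> among the generators turns the inequality hidden in the slack into an equation, so that
the weight is determined by the exponents.\<close>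

lemma weighted_products_monomial:
  assumes W: "finite W" "W \<subseteq> carrier G \<times> UNIV" and x: "(x, n) \<in> weighted_products G W"
  shows "\<exists>d. x = monomial G (insert (\<one>, 1) W) d \<and> n = weight (insert (\<one>, 1) W) d"
proof -
  let ?J = "insert (\<one>, 1) W"
  have J: "finite ?J" "?J \<subseteq> carrier G \<times> UNIV" using W by auto
  show ?thesis using x
  proof (induction rule: weighted_products.induct)
    case (slack n)
    show ?case using monomial_single[OF J, of "(\<one>, 1)" n]
      by (intro exI[of _ "\<lambda>i. if i = (\<one>, 1) then n else 0"]) simp
  next
    case (factor x n w l)
    then obtain d where d: "x = monomial G ?J d" "n = weight ?J d" by blast
    let ?e = "\<lambda>i. if i = (w, l) then 1 else (0::nat)"
    have "monomial G ?J ?e = w" "weight ?J ?e = l"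
      using monomial_single[OF J, of "(w, l)" 1] factor(2) W by auto
    then show ?case
      using d monomial_add[OF J(2), of ?e d] weight_add[of ?J ?e d]
      by (intro exI[of _ "\<lambda>j. ?e j + d j"]) simp
  qed
qed

text \<open>Gordan's lemma: the intersection of a finitely generated monoid with a subgroup is finitely generated.
Exponent vectors with value in \<open>H\<close> are closed under differences, so subtracting elements of a Dickson
basis reduces any of them to zero, where the positive weights make the reduction terminate.\<close>

lemma gordan:
  assumes W: "finite W" "W \<subseteq> carrier G \<times> {0<..}" and H: "subgroup H G"
  shows "\<exists>E. finite E \<and> E \<subseteq> weighted_products G W \<and> E \<subseteq> H \<times> {0<..} \<and>
    (\<forall>x n. (x, n) \<in> weighted_products G W \<longrightarrow> x \<in> H \<longrightarrow> (x, n) \<in> weighted_products G E)"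
proof -
  define J where "J = insert (\<one>, 1::nat) W"
  have W': "W \<subseteq> carrier G \<times> UNIV" using W by auto
  have J: "finite J" "J \<subseteq> carrier G \<times> UNIV" "J \<subseteq> carrier G \<times> {0<..}" using W by (auto simp: J_def)
  define T where "T = {d. monomial G J d \<in> H \<and> weight J d > 0}"
  obtain B where B: "B \<subseteq> T" "finite B" "\<And>d. d \<in> T \<Longrightarrow> \<exists>b\<in>B. \<forall>j\<in>J. b j \<le> d j"
    using dickson[OF J(1), of T] by blast
  define E where "E = (\<lambda>d. (monomial G J d, weight J d)) ` B"
  have "(monomial G J d, weight J d) \<in> weighted_products G E" if "monomial G J d \<in> H" for d
    using that
  proof (induction "weight J d" arbitrary: d rule: less_induct)
    case less
    show ?case
    proof (cases "weight J d = 0")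
      case True
      have "d j = 0" if "j \<in> J" for j
      proof -
        have "d j * snd j = 0" using True that J(1) by (auto simp: weight_def)
        then show ?thesis using that J(3) by auto
      qed
      then have "monomial G J d = \<one>" unfolding monomial_def
        by (intro finprod_one_eqI) simp
      then show ?thesis by (simp add: weighted_products.slack)
    next
      case False
      then have "d \<in> T" using less.prems by (simp add: T_def)
      then obtain b where b: "b \<in> B" "\<forall>j\<in>J. b j \<le> d j" using B(3) by blast
      define e where "e = (\<lambda>j. d j - b j)"
      have bT: "monomial G J b \<in> H" "weight J b > 0" using b B(1) by (auto simp: T_def)
      have split: "monomial G J d = monomial G J b \<otimes> monomial G J e" "weight J d = weight J b + weight J e"
        using monomial_diff[OF J(2), of b d] b(2) by (auto simp: e_def)
      have "monomial G J e = inv (monomial G J b) \<otimes> monomial G J d"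
        using split monomial_closed[OF J(2)] by (simp add: m_assoc[symmetric])
      then have "monomial G J e \<in> H"
        using bT less.prems H by (simp add: subgroup.m_closed subgroup.m_inv_closed)
      then have "(monomial G J e, weight J e) \<in> weighted_products G E"
        using less.hyps[of e] split bT by simp
      then show ?thesis unfolding split
        using b by (intro weighted_products.factor) (auto simp: E_def)
    qed
  qed
  moreover have "\<exists>d. x = monomial G J d \<and> n = weight J d" if "(x, n) \<in> weighted_products G W" for x n
    using weighted_products_monomial[OF W(1) W' that] by (simp add: J_def)
  ultimately have "\<forall>x n. (x, n) \<in> weighted_products G W \<longrightarrow> x \<in> H \<longrightarrow> (x, n) \<in> weighted_products G E"
    by blast
  moreover have "E \<subseteq> weighted_products G W"
    using monomial_in_weighted_products[OF W(1) W'] by (auto simp: E_def J_def)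
  moreover have "E \<subseteq> H \<times> {0<..}" using B(1) by (auto simp: E_def T_def)
  ultimately show ?thesis using B(2) by (intro exI[of _ E]) (simp add: E_def)
qed

text \<open>A rational substitute for the closedness of a polytope. That \<open>h\<^sup>k\<close> equals a weighted product of weight
\<open>k * l + C\<close> up to a fixed factor \<open>c\<close>, for infinitely many \<open>k\<close>, says that \<open>h / l\<close> is a limit of points of the hull.
Dickson's lemma finds two such \<open>k\<close> with comparable exponent vectors; in their difference both error
terms \<open>c\<close> and \<open>C\<close> cancel, leaving an exact expression.\<close>

lemma in_cone_of_linear_growth:
  assumes W: "finite W" "W \<subseteq> carrier G \<times> UNIV" and h: "h \<in> carrier G" "c \<in> carrier G"
    and K: "infinite K"
    and grow: "\<And>k. k \<in> K \<Longrightarrow> \<exists>y. h [^] (k::nat) = y \<otimes> c \<and> (y, k * l + C) \<in> weighted_products G W"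
  shows "in_cone G W h l"
proof -
  define J where "J = insert (\<one>, 1::nat) W"
  have J: "finite J" "J \<subseteq> carrier G \<times> UNIV" using W by (auto simp: J_def)
  have "\<forall>k\<in>K. \<exists>d. h [^] k = monomial G J d \<otimes> c \<and> k * l + C = weight J d"
    using grow weighted_products_monomial[OF W] unfolding J_def by metis
  then obtain \<delta> where \<delta>: "\<And>k. k \<in> K \<Longrightarrow> h [^] k = monomial G J (\<delta> k) \<otimes> c \<and> k * l + C = weight J (\<delta> k)"
    by metis
  obtain B where B: "B \<subseteq> \<delta> ` K" "finite B" "\<And>d. d \<in> \<delta> ` K \<Longrightarrow> \<exists>b\<in>B. \<forall>j\<in>J. b j \<le> d j"
    using dickson[OF J(1), of "\<delta> ` K"] by blast
  obtain K0 where K0: "K0 \<subseteq> K" "finite K0" "B = \<delta> ` K0"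
    using finite_subset_image[OF B(2,1)] by blast
  obtain k where k: "k \<in> K" "\<forall>i\<in>K0. i < k"
  proof -
    obtain m where m: "\<forall>i\<in>K0. i < m" using K0(2) finite_nat_set_iff_bounded by blast
    have "\<not> K \<subseteq> {..<m}" using K finite_subset by blast
    then obtain k where "k \<in> K" "\<not> k < m" by auto
    then show ?thesis using m that by (meson not_less order.strict_trans2)
  qed
  obtain i where i: "i \<in> K0" "\<forall>j\<in>J. \<delta> i j \<le> \<delta> k j" using B(3)[of "\<delta> k"] k K0(3) by auto
  define e where "e = (\<lambda>j. \<delta> k j - \<delta> i j)"
  have split: "monomial G J (\<delta> k) = monomial G J (\<delta> i) \<otimes> monomial G J e"
    "weight J (\<delta> k) = weight J (\<delta> i) + weight J e"
    using monomial_diff[OF J(2), of "\<delta> i" "\<delta> k"] i(2) by (auto simp: e_def)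
  obtain r where r: "k = i + r" "r > 0" using k i by (metis less_imp_add_positive)
  have iK: "i \<in> K" using i K0 by blast
  have m: "monomial G J d \<in> carrier G" for d by (rule monomial_closed[OF J(2)])
  have "h [^] i \<otimes> h [^] r = monomial G J (\<delta> i) \<otimes> monomial G J e \<otimes> c"
    using \<delta>[OF k(1)] split(1) r(1) h by (simp add: nat_pow_mult)
  also have "\<dots> = h [^] i \<otimes> monomial G J e"
    using \<delta>[OF iK] m h by (simp add: m_ac)
  finally have "h [^] r = monomial G J e" using m h by simp
  moreover have "r * l = weight J e"
    using \<delta>[OF k(1)] \<delta>[OF iK] split(2) r by (simp add: algebra_simps)
  ultimately show ?thesis unfolding in_cone_def
    using monomial_in_weighted_products[OF W, of e] r(2) unfolding J_def by metis
qed

end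

section \<open>Finite index, centralisers and conjugation\<close>

lemma (in group) subgroup_pow_closed:
  assumes "subgroup D G" "x \<in> D"
  shows "x [^] (n::nat) \<in> D"
  by (induction n) (use assms in \<open>auto simp: subgroup.one_closed subgroup.m_closed\<close>)

text \<open>Two powers of \<open>x\<close> lie in the same coset.\<close>

lemma (in group) finite_index_power:
  assumes D: "finite_index D G" and x: "x \<in> carrier G"
  shows "\<exists>j>0. x [^] (j::nat) \<in> D"
proof -
  have sD: "subgroup D G" and fD: "finite (rcosets D)" using D by (auto simp: finite_index_def)
  have "range (\<lambda>n::nat. D #> x [^] n) \<subseteq> rcosets D" using x by (auto simp: RCOSETS_def)
  then have "finite (range (\<lambda>n::nat. D #> x [^] n))" using fD finite_subset by blast
  then have "\<not> inj (\<lambda>n::nat. D #> x [^] n)" using finite_imageD infinite_UNIV_nat by blast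
  then obtain m n :: nat where mn: "m < n" "D #> x [^] n = D #> x [^] m"
    unfolding inj_on_def by (metis linorder_neqE_nat)
  then obtain r where r: "n = r + m" "r > 0" by (metis add.commute less_imp_add_positive)
  have "x [^] n \<in> D #> x [^] m" using mn(2) rcos_self[OF _ sD, of "x [^] n"] x by simp
  then obtain d where d: "d \<in> D" "x [^] n = d \<otimes> x [^] m" by (auto simp: r_coset_def)
  have "x [^] r \<otimes> x [^] m = d \<otimes> x [^] m" using d(2) r(1) x by (simp add: nat_pow_mult)
  then have "x [^] r = d" using x subgroup.mem_carrier[OF sD d(1)] by simp
  then show ?thesis using d(1) r(2) by blast
qed

text \<open>The quotient by \<open>D\<close> is a finitely generated torsion abelian group: adding the generator \<open>x\<close> multiplies the
number of coset representatives by at most the exponent of \<open>x\<close> modulo \<open>D\<close>.\<close>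

lemma (in comm_group) finite_index_of_torsion_quotient:
  assumes fg: "finite X" "X \<subseteq> carrier G" "generate G X = carrier G"
    and D: "subgroup D G"
    and tors: "\<And>x. x \<in> carrier G \<Longrightarrow> \<exists>k>0. x [^] (k::nat) \<in> D"
  shows "finite_index D G"
proof -
  have "\<exists>R. finite R \<and> R \<subseteq> carrier G \<and> (\<forall>h\<in>generate G Y. \<exists>d\<in>D. \<exists>r\<in>R. h = d \<otimes> r)"
    if "finite Y" "Y \<subseteq> carrier G" for Y
    using that
  proof (induction Y rule: finite_induct)
    case empty
    show ?case using subgroup.one_closed[OF D]
      by (intro exI[of _ "{\<one>}"]) (auto simp: generate_empty intro!: bexI[of _ \<one>])
  next
    case (insert x Y)
    then obtain R where R: "finite R" "R \<subseteq> carrier G"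
      "\<And>h. h \<in> generate G Y \<Longrightarrow> \<exists>d\<in>D. \<exists>r\<in>R. h = d \<otimes> r" by auto
    have x: "x \<in> carrier G" and Y: "Y \<subseteq> carrier G" using insert by auto
    obtain k where k: "k > 0" "x [^] (k::nat) \<in> D" using tors[OF x] by blast
    note gY = generate_is_subgroup[OF Y]
    note Dc = subgroup.mem_carrier[OF D] and Yc = subgroup.mem_carrier[OF gY]
    have normal_form: "\<exists>d\<in>D. \<exists>i::nat. \<exists>y\<in>generate G Y. h = d \<otimes> x [^] i \<otimes> y"
      if "h \<in> generate G (insert x Y)" for h
      using that
    proof (induction rule: generate.induct)
      case one
      show ?case by (intro bexI[of _ \<one>] exI[of _ 0])
        (auto simp: subgroup.one_closed[OF D] generate.one)
    next
      case (incl h)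
      show ?case
      proof (cases "h = x")
        case True
        then show ?thesis using x
          by (intro bexI[of _ \<one>] exI[of _ 1]) (auto simp: subgroup.one_closed[OF D] generate.one)
      next
        case False
        then have "h \<in> Y" using incl by simp
        then show ?thesis using Y
          by (intro bexI[of _ \<one>] bexI[of _ h] exI[of _ 0])
            (auto simp: subgroup.one_closed[OF D] generate.incl)
      qed
    next
      case (inv h)
      show ?case
      proof (cases "h = x")
        case True
        have "x [^] k = x [^] (k - 1) \<otimes> x" using k(1) by (metis Suc_diff_1 nat_pow_Suc)
        then have "inv h = inv (x [^] k) \<otimes> x [^] (k - 1) \<otimes> \<one>"
          using True x by (simp add: inv_mult m_ac)
        then show ?thesis using k(2) by (meson subgroup.m_inv_closed[OF D] generate.one)
      next
        case False
        then have "h \<in> Y" using inv by simp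
        then show ?thesis using Y
          by (intro bexI[of _ \<one>] bexI[of _ "inv h"] exI[of _ 0])
            (auto simp: subgroup.one_closed[OF D] generate.inv)
      qed
    next
      case (eng h1 h2)
      then obtain d1 i1 y1 d2 i2 y2 where
        e: "d1 \<in> D" "y1 \<in> generate G Y" "h1 = d1 \<otimes> x [^] (i1::nat) \<otimes> y1"
           "d2 \<in> D" "y2 \<in> generate G Y" "h2 = d2 \<otimes> x [^] (i2::nat) \<otimes> y2" by metis
      have "h1 \<otimes> h2 = (d1 \<otimes> d2) \<otimes> x [^] (i1 + i2) \<otimes> (y1 \<otimes> y2)"
        using e Dc Yc x by (simp add: nat_pow_mult[symmetric] m_ac)
      then show ?case using e subgroup.m_closed[OF D] subgroup.m_closed[OF gY] by blast
    qed
    define R' where "R' = (\<lambda>(i, r). x [^] i \<otimes> r) ` ({..<k} \<times> R)"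
    have "\<exists>d\<in>D. \<exists>r\<in>R'. h = d \<otimes> r" if hg: "h \<in> generate G (insert x Y)" for h
    proof -
      obtain d i y where h: "d \<in> D" "y \<in> generate G Y" "h = d \<otimes> x [^] (i::nat) \<otimes> y"
        using normal_form[OF hg] by blast
      obtain d' r where r: "d' \<in> D" "r \<in> R" "y = d' \<otimes> r" using R(3)[OF h(2)] by blast
      \<comment> \<open>Split off the part of the power of \<open>x\<close> that lies in \<open>D\<close>, leaving an exponent below \<open>k\<close>.\<close>
      define q where "q = (x [^] k) [^] (i div k)"
      have q: "q \<in> D" unfolding q_def
        using subgroup_pow_closed[OF D k(2)] .
      have "x [^] i = q \<otimes> x [^] (i mod k)"
        unfolding q_def using x by (simp add: nat_pow_pow nat_pow_mult)
      then have "h = (d \<otimes> q \<otimes> d') \<otimes> (x [^] (i mod k) \<otimes> r)"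
        using h r q Dc R(2) x by (auto simp: m_ac subset_iff)
      moreover have "x [^] (i mod k) \<otimes> r \<in> R'" using r k(1) by (force simp: R'_def)
      ultimately show ?thesis using h(1) q r(1) subgroup.m_closed[OF D] by blast
    qed
    moreover have "finite R'" "R' \<subseteq> carrier G" using R x by (auto simp: R'_def)
    ultimately show ?case by blast
  qed
  then obtain R where R: "finite R" "R \<subseteq> carrier G" "\<forall>h\<in>carrier G. \<exists>d\<in>D. \<exists>r\<in>R. h = d \<otimes> r"
    using fg by metis
  have "rcosets D \<subseteq> (\<lambda>r. D #> r) ` R"
  proof
    fix Z assume "Z \<in> rcosets D"
    then obtain h where h: "h \<in> carrier G" "Z = D #> h" by (auto simp: RCOSETS_def)
    obtain d r where dr: "d \<in> D" "r \<in> R" "h = d \<otimes> r" using R(3) h(1) by blast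
    then have "D #> h = D #> r"
      using repr_independence[of h D r] D R(2) by (auto simp: r_coset_def)
    then show "Z \<in> (\<lambda>r. D #> r) ` R" using h dr by blast
  qed
  then show ?thesis using D R(1) finite_surj by (auto simp: finite_index_def)
qed

lemma (in group_hom) finite_index_kernel:
  assumes "finite (h ` carrier G)"
  shows "finite_index (kernel G H h) G"
proof -
  have s: "subgroup (kernel G H h) G" using normal_kernel normal_imp_subgroup by blast
  have "finite ((\<lambda>x. kernel G H h #>\<^bsub>G\<^esub> x) ` carrier G)"
    using assms
  proof (rule finite_image_if_determined)
    fix x y assume xy: "x \<in> carrier G" "y \<in> carrier G" "h x = h y"
    then have "x \<otimes>\<^bsub>G\<^esub> inv\<^bsub>G\<^esub> y \<in> kernel G H h" by (simp add: kernel_def)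
    moreover have "x = (x \<otimes>\<^bsub>G\<^esub> inv\<^bsub>G\<^esub> y) \<otimes>\<^bsub>G\<^esub> y" using xy by (simp add: G.m_assoc)
    ultimately have "x \<in> kernel G H h #>\<^bsub>G\<^esub> y" unfolding r_coset_def by blast
    then show "kernel G H h #>\<^bsub>G\<^esub> x = kernel G H h #>\<^bsub>G\<^esub> y"
      using G.repr_independence xy s by metis
  qed
  moreover have "rcosets\<^bsub>G\<^esub> (kernel G H h) = (\<lambda>x. kernel G H h #>\<^bsub>G\<^esub> x) ` carrier G"
    by (auto simp: RCOSETS_def)
  ultimately show ?thesis using s by (simp add: finite_index_def)
qed

definition centraliser :: "('a, 'b) monoid_scheme \<Rightarrow> 'a set \<Rightarrow> 'a set" where
  "centraliser G X = {g \<in> carrier G. \<forall>x\<in>X. g \<otimes>\<^bsub>G\<^esub> x = x \<otimes>\<^bsub>G\<^esub> g}"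

lemma (in group) subgroup_centraliser:
  assumes "X \<subseteq> carrier G"
  shows "subgroup (centraliser G X) G"
proof (rule subgroup.intro)
  fix a b assume a: "a \<in> centraliser G X" and b: "b \<in> centraliser G X"
  have "a \<otimes> b \<otimes> x = x \<otimes> (a \<otimes> b)" if x: "x \<in> X" for x
  proof -
    have c: "a \<in> carrier G" "b \<in> carrier G" "x \<in> carrier G" "a \<otimes> x = x \<otimes> a" "b \<otimes> x = x \<otimes> b"
      using a b x assms by (auto simp: centraliser_def)
    have "a \<otimes> b \<otimes> x = (a \<otimes> x) \<otimes> b" using c(1-3,5) by (simp add: m_assoc)
    then show ?thesis using c(1-4) by (simp add: m_assoc)
  qed
  then show "a \<otimes> b \<in> centraliser G X" using a b by (auto simp: centraliser_def)
next
  fix a assume a: "a \<in> centraliser G X"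
  have "inv a \<otimes> x = x \<otimes> inv a" if x: "x \<in> X" for x
  proof -
    have c: "a \<in> carrier G" "x \<in> carrier G" "a \<otimes> x = x \<otimes> a"
      using a x assms by (auto simp: centraliser_def)
    have "inv a \<otimes> x = inv a \<otimes> (x \<otimes> a) \<otimes> inv a" using c by (simp add: m_assoc)
    also have "\<dots> = inv a \<otimes> (a \<otimes> x) \<otimes> inv a" using c by simp
    also have "\<dots> = x \<otimes> inv a" using c(1,2) inv_cancel[of a x] by (simp add: m_assoc)
    finally show ?thesis .
  qed
  then show "inv a \<in> centraliser G X" using a by (auto simp: centraliser_def)
qed (use assms in \<open>auto simp: centraliser_def\<close>)

lemma (in group) conj_nat_pow:
  assumes "g \<in> carrier G" "h \<in> carrier G"
  shows "(g \<otimes> h \<otimes> inv g) [^] (k::nat) = g \<otimes> h [^] k \<otimes> inv g"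
proof (induction k)
  case (Suc k)
  have "(g \<otimes> h [^] k \<otimes> inv g) \<otimes> (g \<otimes> h \<otimes> inv g) = g \<otimes> (h [^] k \<otimes> h) \<otimes> inv g"
    using assms by (simp add: m_assoc inv_cancel)
  then show ?case using Suc by simp
qed (use assms in auto)

section \<open>Words in a biautomatic group\<close>

text \<open>The biautomatic structure with its automaton unpacked. The fellow traveller constant enters only through
the fact that the differences between prefixes lie in a finite set.\<close>

locale biautomatic_group = group G for G :: "('a, 'b) monoid_scheme" (structure) +
  fixes Y :: "'y set" and \<iota> :: "'y \<Rightarrow> 'a" and M :: "'y list set"
    and Q :: "nat set" and q\<^sub>0 :: nat and \<delta> :: "nat \<Rightarrow> 'y \<Rightarrow> nat" and F :: "nat set"
  assumes finite_alphabet: "finite Y"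
    and letters: "\<iota> ` Y \<subseteq> carrier G"
    and identity_letter: "\<one> \<in> \<iota> ` Y"
    and finite_states: "finite Q"
    and start: "q\<^sub>0 \<in> Q"
    and transition: "\<And>q y. q \<in> Q \<Longrightarrow> y \<in> Y \<Longrightarrow> \<delta> q y \<in> Q"
    and language: "M = {w \<in> lists Y. foldl \<delta> q\<^sub>0 w \<in> F}"
    and onto: "word_val G \<iota> ` M = carrier G"
    and fellow: "\<exists>B. finite B \<and> (\<forall>U\<in>M. \<forall>V\<in>M. \<forall>x\<in>Y. \<forall>y\<in>Y.
        word_val G \<iota> U = word_val G \<iota> (x # V @ [y]) \<longrightarrow>
        (\<forall>t. inv (word_val G \<iota> (take t U)) \<otimes> \<iota> x \<otimes> word_val G \<iota> (take t V) \<in> B))"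
begin

abbreviation val :: "'y list \<Rightarrow> 'a" where "val \<equiv> word_val G \<iota>"

lemma letter_closed [simp]: "y \<in> Y \<Longrightarrow> \<iota> y \<in> carrier G"
  using letters by auto

lemma val_Nil [simp]: "val [] = \<one>"
  and val_Cons [simp]: "val (y # w) = \<iota> y \<otimes> val w"
  by (simp_all add: word_val_def)

lemma val_closed [simp]: "w \<in> lists Y \<Longrightarrow> val w \<in> carrier G"
  by (induction w) auto

lemma val_append [simp]:
  "u \<in> lists Y \<Longrightarrow> w \<in> lists Y \<Longrightarrow> val (u @ w) = val u \<otimes> val w"
  by (induction u) (auto simp: m_assoc)

lemma lists_take [simp]: "w \<in> lists Y \<Longrightarrow> take t w \<in> lists Y"
  and lists_drop [simp]: "w \<in> lists Y \<Longrightarrow> drop t w \<in> lists Y"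
  by (meson in_listsD in_listsI in_set_takeD) (meson in_listsD in_listsI in_set_dropD)

lemma val_take_drop: "w \<in> lists Y \<Longrightarrow> val (take t w) \<otimes> val (drop t w) = val w"
  by (metis append_take_drop_id lists_drop lists_take val_append)

lemma lang_lists [simp]: "U \<in> M \<Longrightarrow> U \<in> lists Y"
  using language by auto

lemma langI: "U \<in> M \<Longrightarrow> W \<in> lists Y \<Longrightarrow> foldl \<delta> q\<^sub>0 W = foldl \<delta> q\<^sub>0 U \<Longrightarrow> W \<in> M"
  unfolding language by simp

lemma run_closed: "w \<in> lists Y \<Longrightarrow> foldl \<delta> q\<^sub>0 w \<in> Q"
  by (induction w rule: rev_induct) (auto simp: start transition)

lemma ex_word: "g \<in> carrier G \<Longrightarrow> \<exists>U\<in>M. val U = g"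
  using onto by (metis image_iff)

definition fellow_travel :: "'a \<Rightarrow> 'a \<Rightarrow> bool" where
  "fellow_travel a b \<longleftrightarrow> (\<exists>D. finite D \<and> (\<forall>U\<in>M. \<forall>V\<in>M. val U = a \<otimes> val V \<otimes> b \<longrightarrow>
     (\<forall>t. inv (val (take t U)) \<otimes> a \<otimes> val (take t V) \<in> D)))"

text \<open>An accepted word for \<open>x V y\<close> lies between the two given ones.\<close>

lemma fellow_travel_step:
  assumes ab: "fellow_travel a b" "a \<in> carrier G" "b \<in> carrier G" and xy: "x \<in> Y" "y \<in> Y"
  shows "fellow_travel (a \<otimes> \<iota> x) (\<iota> y \<otimes> b)"
proof -
  obtain D where D: "finite D" "\<And>U V t. U \<in> M \<Longrightarrow> V \<in> M \<Longrightarrow> val U = a \<otimes> val V \<otimes> b \<Longrightarrow>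
     inv (val (take t U)) \<otimes> a \<otimes> val (take t V) \<in> D"
    using ab(1) unfolding fellow_travel_def by blast
  obtain B where B0: "finite B" "\<forall>U\<in>M. \<forall>V\<in>M. \<forall>x\<in>Y. \<forall>y\<in>Y. val U = val (x # V @ [y]) \<longrightarrow>
     (\<forall>t. inv (val (take t U)) \<otimes> \<iota> x \<otimes> val (take t V) \<in> B)"
    using fellow by blast
  note B = B0(1) B0(2)[rule_format, OF _ _ xy]
  have "inv (val (take t U)) \<otimes> (a \<otimes> \<iota> x) \<otimes> val (take t V) \<in> (\<lambda>(d, b). d \<otimes> b) ` (D \<times> B)"
    if UV: "U \<in> M" "V \<in> M" "val U = (a \<otimes> \<iota> x) \<otimes> val V \<otimes> (\<iota> y \<otimes> b)" for U V t
  proof -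
    have c: "val (take t U) \<in> carrier G" "val (take t V) \<in> carrier G" "val V \<in> carrier G"
      "\<iota> x \<in> carrier G" "\<iota> y \<in> carrier G"
      using UV xy by simp_all
    have "val (x # V @ [y]) \<in> carrier G" using UV xy by simp
    then obtain W where W: "W \<in> M" "val W = val (x # V @ [y])" using ex_word by blast
    have "val U = a \<otimes> val W \<otimes> b" using UV W xy ab c by (simp add: m_assoc)
    then have d: "inv (val (take t U)) \<otimes> a \<otimes> val (take t W) \<in> D" using D(2) UV W by blast
    have e: "inv (val (take t W)) \<otimes> \<iota> x \<otimes> val (take t V) \<in> B" using B(2) UV W by blast
    have w: "val (take t W) \<in> carrier G" using W by simp
    have "inv (val (take t U)) \<otimes> (a \<otimes> \<iota> x) \<otimes> val (take t V) =
      (inv (val (take t U)) \<otimes> a \<otimes> val (take t W)) \<otimes> (inv (val (take t W)) \<otimes> \<iota> x \<otimes> val (take t V))"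
      using c w ab by (simp add: m_assoc inv_cancel)
    then show ?thesis using d e by force
  qed
  then show ?thesis unfolding fellow_travel_def
    using D(1) B(1) by (intro exI[of _ "(\<lambda>(d, b). d \<otimes> b) ` (D \<times> B)"]) auto
qed

text \<open>Write \<open>a\<close> and \<open>b\<close> as words and change one letter at a time, on one side, with the identity letter on the other.\<close>

lemma fellow_travel:
  assumes "a \<in> carrier G" "b \<in> carrier G"
  shows "fellow_travel a b"
proof -
  obtain e where e: "e \<in> Y" "\<iota> e = \<one>" using identity_letter by auto
  have "fellow_travel \<one> \<one>"
  proof -
    obtain B where B0: "finite B" "\<forall>U\<in>M. \<forall>V\<in>M. \<forall>x\<in>Y. \<forall>y\<in>Y. val U = val (x # V @ [y]) \<longrightarrow>
       (\<forall>t. inv (val (take t U)) \<otimes> \<iota> x \<otimes> val (take t V) \<in> B)"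
      using fellow by blast
    have "inv (val (take t U)) \<otimes> \<one> \<otimes> val (take t V) \<in> B"
      if "U \<in> M" "V \<in> M" "val U = \<one> \<otimes> val V \<otimes> \<one>" for U V t
      using B0(2)[rule_format, of U V e e t] that e by simp
    then show ?thesis unfolding fellow_travel_def using B0(1) by blast
  qed
  moreover have "fellow_travel (val u) \<one>" if "u \<in> lists Y" "fellow_travel \<one> \<one>" for u
    using that
  proof (induction u rule: rev_induct)
    case (snoc x u)
    then show ?case using fellow_travel_step[of "val u" \<one> x e] e by simp
  qed simp
  moreover have "fellow_travel a (val v)" if "v \<in> lists Y" "fellow_travel a \<one>" for v
    using that
  proof (induction v)
    case (Cons y v)
    then show ?case using fellow_travel_step[of a "val v" e y] e assms(1) by simp
  qed simp
  ultimately show ?thesis using ex_word assms by (metis lang_lists)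
qed

text \<open>Let \<open>U\<close> be a shortest accepted word for \<open>a V b\<close>. After \<open>V\<close> has ended, the prefixes of \<open>U\<close> keep within a finite
distance of its end, so they take finitely many values. If \<open>U\<close> went on for too long, then two of these
prefixes would agree in value and in automaton state, and the part between them could be cut out.\<close>

lemma translation_length_bound:
  assumes "a \<in> carrier G" "b \<in> carrier G"
  shows "\<exists>K. \<forall>V\<in>M. \<exists>U\<in>M. val U = a \<otimes> val V \<otimes> b \<and> length U \<le> length V + K"
proof -
  obtain D where D: "finite D" "\<And>U V t. U \<in> M \<Longrightarrow> V \<in> M \<Longrightarrow> val U = a \<otimes> val V \<otimes> b \<Longrightarrow>
     inv (val (take t U)) \<otimes> a \<otimes> val (take t V) \<in> D"
    using fellow_travel[OF assms] unfolding fellow_travel_def by blast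
  have "\<exists>U\<in>M. val U = a \<otimes> val V \<otimes> b \<and> length U \<le> length V + card (Q \<times> D)" if V: "V \<in> M" for V
  proof -
    define P where "P U \<longleftrightarrow> U \<in> M \<and> val U = a \<otimes> val V \<otimes> b" for U
    have "\<exists>U. P U" using ex_word[of "a \<otimes> val V \<otimes> b"] assms V unfolding P_def by auto
    then obtain U where U: "P U" "\<And>W. P W \<Longrightarrow> length U \<le> length W"
      using ex_has_least_nat[of P _ length] by blast
    have UM: "U \<in> M" "U \<in> lists Y" "val U = a \<otimes> val V \<otimes> b" using U(1) unfolding P_def by auto
    define f where "f t = (foldl \<delta> q\<^sub>0 (take t U), inv (val (take t U)) \<otimes> a \<otimes> val V)" for t
    have "length U \<le> length V + card (Q \<times> D)"
    proof (rule ccontr)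
      assume long: "\<not> length U \<le> length V + card (Q \<times> D)"
      have "f t \<in> Q \<times> D" if "t \<in> {length V..length U}" for t
      proof -
        have "take t V = V" using that by simp
        then show ?thesis
          using D(2)[OF UM(1) V UM(3), of t] run_closed[OF lists_take[OF UM(2)]] by (simp add: f_def)
      qed
      then have "f ` {length V..length U} \<subseteq> Q \<times> D" by blast
      then have "card (f ` {length V..length U}) \<le> card (Q \<times> D)"
        using finite_states D(1) by (intro card_mono) auto
      also have "\<dots> < card {length V..length U}" using long by simp
      finally have "\<not> inj_on f {length V..length U}" by (rule pigeonhole)
      then obtain s t where st: "s < t" "t \<le> length U" "f s = f t"
        unfolding inj_on_def by (metis atLeastAtMost_iff linorder_neqE_nat)
      have c: "val (take s U) \<in> carrier G" "val (take t U) \<in> carrier G" "val V \<in> carrier G"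
        using UM V by simp_all
      have "inv (val (take s U)) \<otimes> (a \<otimes> val V) = inv (val (take t U)) \<otimes> (a \<otimes> val V)"
        using st(3) c assms by (simp add: f_def m_assoc)
      then have eq: "val (take s U) = val (take t U)" 
        using right_cancel[of "a \<otimes> val V" "inv (val (take s U))" "inv (val (take t U))"] c assms
        by (metis inv_closed inv_inv m_closed)
      let ?W = "take s U @ drop t U"
      have "foldl \<delta> q\<^sub>0 ?W = foldl \<delta> q\<^sub>0 (take t U @ drop t U)"
        using st(3) by (simp only: foldl_append) (simp add: f_def)
      then have "?W \<in> M" using UM(2) by (intro langI[OF UM(1)]) simp_all
      moreover have "val ?W = val U" using eq UM(2) val_take_drop[of U t] by simp
      ultimately have "P ?W" using UM by (simp add: P_def)
      then show False using U(2)[of ?W] st by simp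
    qed
    then show ?thesis using UM by blast
  qed
  then show ?thesis by blast
qed

section \<open>Centralisers and an abelian overgroup\<close>

text \<open>Finiteness of this set of cosets says that \<open>A\<close> is quasiconvex with respect to the language.\<close>

definition prefix_cosets :: "'a set \<Rightarrow> 'a set set" where
  "prefix_cosets A = {A #> val (take t U) |t U. U \<in> M \<and> val U \<in> A}"

text \<open>If the value of \<open>U\<close> commutes with \<open>x\<close>, then \<open>U\<close> fellow travels with its own translate by \<open>x\<close>. Hence a prefix
\<open>p\<close> of \<open>U\<close> conjugates the elements of \<open>X\<close> into finite sets, and these conjugates determine the coset of \<open>p\<close>.\<close>

lemma finite_prefix_cosets_centraliser:
  assumes X: "finite X" "X \<subseteq> carrier G"
  shows "finite (prefix_cosets (centraliser G X))"
proof -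
  let ?C = "centraliser G X"
  have "\<forall>x\<in>X. \<exists>D. finite D \<and> (\<forall>U\<in>M. \<forall>V\<in>M. val U = x \<otimes> val V \<otimes> inv x \<longrightarrow>
     (\<forall>t. inv (val (take t U)) \<otimes> x \<otimes> val (take t V) \<in> D))"
    using fellow_travel X unfolding fellow_travel_def by auto
  from bchoice[OF this] obtain D where D0: "\<forall>x\<in>X. finite (D x) \<and> (\<forall>U\<in>M. \<forall>V\<in>M.
     val U = x \<otimes> val V \<otimes> inv x \<longrightarrow> (\<forall>t. inv (val (take t U)) \<otimes> x \<otimes> val (take t V) \<in> D x))"
    by (rule exE)
  then have D: "\<And>x. x \<in> X \<Longrightarrow> finite (D x)"
    "\<And>x U V t. x \<in> X \<Longrightarrow> U \<in> M \<Longrightarrow> V \<in> M \<Longrightarrow> val U = x \<otimes> val V \<otimes> inv x \<Longrightarrow>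
       inv (val (take t U)) \<otimes> x \<otimes> val (take t V) \<in> D x"
    by simp_all
  define P where "P = {val (take t U) |t U. U \<in> M \<and> val U \<in> ?C}"
  define f where "f g = restrict (\<lambda>x. inv g \<otimes> x \<otimes> g) X" for g
  have "f ` P \<subseteq> Pi\<^sub>E X D"
  proof clarify
    fix g assume "g \<in> P"
    then obtain t U where U: "g = val (take t U)" "U \<in> M" "val U \<in> ?C" by (auto simp: P_def)
    have "inv g \<otimes> x \<otimes> g \<in> D x" if x: "x \<in> X" for x
    proof -
      have "val U \<otimes> x = x \<otimes> val U" "x \<in> carrier G" "val U \<in> carrier G"
        using U x X by (auto simp: centraliser_def)
      then have "val U = x \<otimes> val U \<otimes> inv x" by (metis inv_solve_right m_closed)
      then show ?thesis using D(2)[OF x U(2) U(2)] U(1) by blast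
    qed
    then show "f g \<in> Pi\<^sub>E X D" by (auto simp: f_def)
  qed
  then have "finite (f ` P)" using X(1) D(1) by (meson finite_PiE finite_subset)
  then have "finite ((\<lambda>g. ?C #> g) ` P)"
  proof (rule finite_image_if_determined)
    fix g h assume gh: "g \<in> P" "h \<in> P" "f g = f h"
    have c: "g \<in> carrier G" "h \<in> carrier G" using gh by (auto simp: P_def)
    have "g \<otimes> inv h \<otimes> x = x \<otimes> (g \<otimes> inv h)" if x: "x \<in> X" for x
    proof -
      have xc: "x \<in> carrier G" using x X by auto
      have e: "inv h \<otimes> x \<otimes> h = inv g \<otimes> x \<otimes> g" using gh(3) x by (metis f_def restrict_apply')
      have "g \<otimes> inv h \<otimes> x = g \<otimes> (inv h \<otimes> x \<otimes> h) \<otimes> inv h" using c xc by (simp add: m_assoc)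
      also have "\<dots> = x \<otimes> (g \<otimes> inv h)" unfolding e using c xc by (simp add: m_assoc inv_cancel)
      finally show ?thesis .
    qed
    then have "g \<otimes> inv h \<in> ?C" using c by (simp add: centraliser_def)
    moreover have "g = (g \<otimes> inv h) \<otimes> h" using c by (simp add: m_assoc)
    ultimately have "g \<in> ?C #> h" unfolding r_coset_def by blast
    then show "?C #> g = ?C #> h"
      using repr_independence c subgroup_centraliser[OF X(2)] by metis
  qed
  moreover have "prefix_cosets ?C = (\<lambda>g. ?C #> g) ` P"
    unfolding prefix_cosets_def P_def by blast
  ultimately show ?thesis by simp
qed

text \<open>A centraliser of a finite set is finitely generated: along an accepted word for one of its elements, every
letter can be corrected by the chosen representatives of the finitely many cosets of prefixes so as to lie in
the centraliser. An element that commutes with these corrected letters therefore commutes with all of it.\<close>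

lemma finite_subset_same_centraliser:
  assumes X: "finite X" "X \<subseteq> carrier G"
  shows "\<exists>X'. finite X' \<and> X' \<subseteq> centraliser G X \<and>
    centraliser G X' = centraliser G (centraliser G X)"
proof -
  let ?C = "centraliser G X"
  note sC = subgroup_centraliser[OF X(2)]
  note Cc = subgroup.mem_carrier[OF sC]
  define \<rho> where "\<rho> s = (SOME g. g \<in> s)" for s :: "'a set"
  have \<rho>: "\<rho> (?C #> g) \<in> carrier G" "g \<otimes> inv (\<rho> (?C #> g)) \<in> ?C" if g: "g \<in> carrier G" for g
  proof -
    have "g \<in> ?C #> g" using rcos_self[OF g sC] .
    then have "\<rho> (?C #> g) \<in> ?C #> g" unfolding \<rho>_def by (rule someI)
    then obtain c where c: "c \<in> ?C" "\<rho> (?C #> g) = c \<otimes> g" unfolding r_coset_def by blast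
    then show "\<rho> (?C #> g) \<in> carrier G" using g Cc by simp
    have "g \<otimes> inv (\<rho> (?C #> g)) = inv c" using c g Cc by (simp add: inv_mult_group inv_cancel m_assoc[symmetric])
    then show "g \<otimes> inv (\<rho> (?C #> g)) \<in> ?C" using subgroup.m_inv_closed[OF sC c(1)] by simp
  qed
  define S where "S = prefix_cosets ?C"
  have S: "finite S" unfolding S_def by (rule finite_prefix_cosets_centraliser[OF X])
  define X' where "X' = ?C \<inter> insert (\<rho> (?C #> \<one>))
      ((\<lambda>(s, y, s'). \<rho> s \<otimes> \<iota> y \<otimes> inv (\<rho> s')) ` (S \<times> Y \<times> S))"
  have fin: "finite X'" unfolding X'_def using S finite_alphabet by auto
  have sub: "X' \<subseteq> ?C" by (auto simp: X'_def)
  have \<rho>1: "\<rho> (?C #> \<one>) \<in> ?C"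
    using \<rho>[of \<one>] subgroup.m_inv_closed[OF sC, of "inv (\<rho> (?C #> \<one>))"] by simp
  have \<rho>X': "\<rho> (?C #> \<one>) \<in> X'" using \<rho>1 by (simp add: X'_def)
  have X'c: "X' \<subseteq> carrier G" using sub Cc by blast
  have "centraliser G X' \<subseteq> centraliser G ?C"
  proof
    fix z assume z: "z \<in> centraliser G X'"
    then have zc: "z \<in> carrier G" by (simp add: centraliser_def)
    \<comment> \<open>The elements commuting with \<open>z\<close> form a subgroup that contains the candidate generators; it suffices that it
      contains the centraliser of \<open>X\<close>.\<close>
    let ?Z = "centraliser G {z}"
    have sZ: "subgroup ?Z G" using zc by (intro subgroup_centraliser) auto
    have X'Z: "X' \<subseteq> ?Z" using z X'c unfolding centraliser_def by auto
    have "c \<in> ?Z" if c: "c \<in> ?C" for c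
    proof -
      obtain U where U: "U \<in> M" "val U = c" using ex_word c Cc by blast
      have "val (take t U) \<otimes> inv (\<rho> (?C #> val (take t U))) \<in> ?Z" if "t \<le> length U" for t
        using that
      proof (induction t)
        case 0
        have "\<rho> (?C #> \<one>) \<in> ?Z" using X'Z \<rho>X' by blast
        then show ?case using subgroup.m_inv_closed[OF sZ] subgroup.mem_carrier[OF sZ] by simp
      next
        case (Suc t)
        define p p' y where "p = val (take t U)" and "p' = val (take (Suc t) U)" and "y = U ! t"
        have yY: "y \<in> Y" using Suc.prems in_listsD[OF lang_lists[OF U(1)]] nth_mem[of t U] by (simp add: y_def)
        have p': "p' = p \<otimes> \<iota> y" using Suc.prems U yY
          by (simp add: p_def p'_def y_def take_Suc_conv_app_nth)
        have pc: "p \<in> carrier G" "p' \<in> carrier G" using U by (simp_all add: p_def p'_def)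
        let ?r = "\<rho> (?C #> p)" and ?r' = "\<rho> (?C #> p')"
        note r = \<rho>[OF pc(1)] and r' = \<rho>[OF pc(2)]
        have eq: "p' \<otimes> inv ?r' = (p \<otimes> inv ?r) \<otimes> (?r \<otimes> \<iota> y \<otimes> inv ?r')"
          using pc r(1) r'(1) yY p' by (simp add: m_assoc inv_cancel)
        then have "?r \<otimes> \<iota> y \<otimes> inv ?r' = inv (p \<otimes> inv ?r) \<otimes> (p' \<otimes> inv ?r')"
          using pc r(1) r'(1) yY by (simp add: inv_solve_left)
        then have "?r \<otimes> \<iota> y \<otimes> inv ?r' \<in> ?C"
          using r(2) r'(2) subgroup.m_closed[OF sC] subgroup.m_inv_closed[OF sC] by simp
        moreover have "?C #> p \<in> S" "?C #> p' \<in> S"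
          using U c unfolding S_def prefix_cosets_def p_def p'_def by blast+
        ultimately have "?r \<otimes> \<iota> y \<otimes> inv ?r' \<in> X'" unfolding X'_def using yY by force
        then show ?case
          using Suc X'Z eq subgroup.m_closed[OF sZ] unfolding p_def p'_def by auto
      qed
      from this[of "length U"] have "c \<otimes> inv (\<rho> (?C #> c)) \<in> ?Z" using U by simp
      moreover have "?C #> c = ?C #> \<one>"
        using c sC Cc by (metis coset_join2 coset_mult_one subgroup.subset)
      moreover have "\<rho> (?C #> \<one>) \<in> ?Z" using X'Z \<rho>X' by blast
      ultimately have "(c \<otimes> inv (\<rho> (?C #> \<one>))) \<otimes> \<rho> (?C #> \<one>) \<in> ?Z"
        using subgroup.m_closed[OF sZ] by metis
      then show ?thesis using Cc[OF c] Cc[OF \<rho>1] by (simp add: m_assoc)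
    qed
    then show "z \<in> centraliser G ?C" using zc by (auto simp: centraliser_def)
  qed
  moreover have "centraliser G ?C \<subseteq> centraliser G X'" using sub by (auto simp: centraliser_def)
  ultimately show ?thesis using fin sub by blast
qed

text \<open>The double centraliser of \<open>H\<close> contains \<open>H\<close>. As \<open>H\<close> is abelian, it is also contained in the centraliser of
\<open>H\<close>, all of whose elements it centralises, and so it is abelian. It is the centraliser of a finite set,
because the centraliser of \<open>H\<close> is finitely generated.\<close>

lemma abelian_overgroup:
  assumes H: "subgroup H G" and comm: "\<And>x y. x \<in> H \<Longrightarrow> y \<in> H \<Longrightarrow> x \<otimes> y = y \<otimes> x"
    and X: "finite X" "X \<subseteq> H" "H \<subseteq> generate G X"
  shows "\<exists>A. subgroup A G \<and> comm_group (G\<lparr>carrier := A\<rparr>) \<and> H \<subseteq> A \<and> finite (prefix_cosets A)"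
proof -
  note Hc = subgroup.mem_carrier[OF H]
  have Xc: "X \<subseteq> carrier G" using X Hc by auto
  let ?C = "centraliser G X"
  have Cc: "?C \<subseteq> carrier G" by (auto simp: centraliser_def)
  obtain X' where X': "finite X'" "X' \<subseteq> ?C" "centraliser G X' = centraliser G ?C"
    using finite_subset_same_centraliser[OF X(1) Xc] by blast
  have X'c: "X' \<subseteq> carrier G" using X' Cc by auto
  let ?A = "centraliser G ?C"
  have sA: "subgroup ?A G" by (rule subgroup_centraliser[OF Cc])
  have "finite (prefix_cosets ?A)"
    using finite_prefix_cosets_centraliser[OF X'(1) X'c] X'(3) by simp
  moreover have HA: "H \<subseteq> ?A"
  proof
    fix h assume h: "h \<in> H"
    have "h \<otimes> c = c \<otimes> h" if c: "c \<in> ?C" for c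
    proof -
      have "X \<subseteq> centraliser G {c}" using c Xc by (auto simp: centraliser_def)
      then have "generate G X \<subseteq> centraliser G {c}"
        using c Cc by (intro generate_subgroup_incl subgroup_centraliser) auto
      then show ?thesis using h X(3) by (auto simp: centraliser_def)
    qed
    then show "h \<in> ?A" using Hc[OF h] by (simp add: centraliser_def)
  qed
  moreover have "comm_group (G\<lparr>carrier := ?A\<rparr>)"
  proof (rule group.group_comm_groupI)
    show "group (G\<lparr>carrier := ?A\<rparr>)" by (rule subgroup_imp_group[OF sA])
    fix x y assume xy: "x \<in> carrier (G\<lparr>carrier := ?A\<rparr>)" "y \<in> carrier (G\<lparr>carrier := ?A\<rparr>)"
    have "H \<subseteq> ?C" using comm X Hc by (auto simp: centraliser_def)
    then have "?A \<subseteq> ?C" using X(2) by (auto simp: centraliser_def)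
    then show "x \<otimes>\<^bsub>G\<lparr>carrier := ?A\<rparr>\<^esub> y = y \<otimes>\<^bsub>G\<lparr>carrier := ?A\<rparr>\<^esub> x"
      using xy by (auto simp: centraliser_def)
  qed
  ultimately show ?thesis using sA by blast
qed

section \<open>Inserting and erasing loops\<close>

text \<open>The prefixes of accepted words with value in \<open>A\<close> trace paths in the finite graph of these vertices.\<close>

definition vertex :: "'a set \<Rightarrow> 'y list \<Rightarrow> nat \<times> 'a set" where
  "vertex A p = (foldl \<delta> q\<^sub>0 p, A #> val p)"

definition visited :: "'a set \<Rightarrow> 'y list \<Rightarrow> (nat \<times> 'a set) set" where
  "visited A U = range (\<lambda>t. vertex A (take t U))"

text \<open>The loop \<open>\<beta>\<close> at the vertex of \<open>p\<close> returns to the same coset of \<open>A\<close>; conjugating its value by \<open>p\<close> yields an element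
of \<open>A\<close>. The bound on the length keeps the set finite.\<close>

definition loops :: "'a set \<Rightarrow> (nat \<times> 'a set) set \<Rightarrow> nat \<Rightarrow> ('a \<times> nat) set" where
  "loops A S n = {(val p \<otimes> val \<beta> \<otimes> inv (val p), length \<beta>) |p \<beta>.
     p \<in> lists Y \<and> \<beta> \<in> lists Y \<and> vertex A p \<in> S \<and> vertex A (p @ \<beta>) = vertex A p \<and>
     0 < length \<beta> \<and> length \<beta> \<le> n}"

lemma vertex_append:
  assumes A: "subgroup A G" and "p \<in> lists Y" "p' \<in> lists Y" "w \<in> lists Y"
    and "vertex A p = vertex A p'"
  shows "vertex A (p @ w) = vertex A (p' @ w)"
proof -
  have "A #> (val p \<otimes> val w) = A #> (val p' \<otimes> val w)"
    using assms subgroup.subset[OF A] by (simp add: vertex_def coset_mult_assoc[symmetric])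
  then show ?thesis using assms by (simp add: vertex_def)
qed

text \<open>Two prefixes leading to the same vertex differ by an element of \<open>A\<close>, which commutes with the value of the
loop. So this value depends on the vertex and the loop only.\<close>

lemma loop_value:
  assumes A: "subgroup A G" and comm: "comm_group (G\<lparr>carrier := A\<rparr>)"
    and w: "p \<in> lists Y" "p' \<in> lists Y" "\<beta> \<in> lists Y"
    and v: "vertex A p = vertex A p'" "vertex A (p @ \<beta>) = vertex A p"
  shows "val p \<otimes> val \<beta> \<otimes> inv (val p) \<in> A"
    "val p \<otimes> val \<beta> \<otimes> inv (val p) = val p' \<otimes> val \<beta> \<otimes> inv (val p')"
proof -
  note Ac = subgroup.mem_carrier[OF A]
  have c: "val p \<in> carrier G" "val p' \<in> carrier G" "val \<beta> \<in> carrier G" using w by simp_all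
  have "val p \<otimes> val \<beta> \<in> A #> val p"
    using v(2) w rcos_self[OF _ A, of "val p \<otimes> val \<beta>"] c by (simp add: vertex_def)
  then obtain a where a: "a \<in> A" "val p \<otimes> val \<beta> = a \<otimes> val p" by (auto simp: r_coset_def)
  have ae: "val p \<otimes> val \<beta> \<otimes> inv (val p) = a" using a Ac c by (simp add: m_assoc)
  then show "val p \<otimes> val \<beta> \<otimes> inv (val p) \<in> A" using a by simp
  have "val p' \<in> A #> val p"
    using v(1) rcos_self[OF c(2) A] by (simp add: vertex_def)
  then obtain b where b: "b \<in> A" "val p' = b \<otimes> val p" by (auto simp: r_coset_def)
  have "val p' \<otimes> val \<beta> \<otimes> inv (val p') = b \<otimes> (val p \<otimes> val \<beta> \<otimes> inv (val p)) \<otimes> inv b"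
    using b Ac c by (simp add: inv_mult_group m_assoc)
  also have "\<dots> = a \<otimes> b \<otimes> inv b"
    unfolding ae using comm_group.axioms(1)[OF comm] a b comm_monoid.m_comm[of "G\<lparr>carrier := A\<rparr>" a b]
    by simp
  also have "\<dots> = a" using a b Ac by (simp add: m_assoc)
  finally show "val p \<otimes> val \<beta> \<otimes> inv (val p) = val p' \<otimes> val \<beta> \<otimes> inv (val p')" using ae by simp
qed

lemma loops_subset:
  assumes "subgroup A G" "comm_group (G\<lparr>carrier := A\<rparr>)"
  shows "loops A S n \<subseteq> A \<times> {0<..}"
  using loop_value(1)[OF assms] by (auto simp: loops_def)

lemma finite_loops:
  assumes A: "subgroup A G" "comm_group (G\<lparr>carrier := A\<rparr>)" and S: "finite S"
  shows "finite (loops A S n)"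
proof -
  define P where "P = {(p, \<beta>). p \<in> lists Y \<and> \<beta> \<in> lists Y \<and> vertex A p \<in> S \<and>
     vertex A (p @ \<beta>) = vertex A p \<and> 0 < length \<beta> \<and> length \<beta> \<le> n}"
  define f where "f = (\<lambda>(p, \<beta>). (vertex A p, \<beta> :: 'y list))"
  have "f ` P \<subseteq> S \<times> {w. set w \<subseteq> Y \<and> length w \<le> n}"
    by (auto simp: P_def f_def)
  then have "finite (f ` P)"
    using S finite_lists_length_le[OF finite_alphabet] finite_subset by blast
  then have "finite ((\<lambda>(p, \<beta>). (val p \<otimes> val \<beta> \<otimes> inv (val p), length \<beta>)) ` P)"
    by (rule finite_image_if_determined)
      (auto simp: P_def f_def intro: loop_value(2)[OF A])
  moreover have "loops A S n = (\<lambda>(p, \<beta>). (val p \<otimes> val \<beta> \<otimes> inv (val p), length \<beta>)) ` P"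
    by (force simp: loops_def P_def)
  ultimately show ?thesis by simp
qed

lemma take_insert_after:
  "length a \<le> s \<Longrightarrow> take s (a @ c) = a @ take (s - length a) c"
  "length a \<le> s \<Longrightarrow> take (s + length b) (a @ b @ c) = (a @ b) @ take (s - length a) c"
  by simp_all

text \<open>The loop is inserted at a visit to its vertex. As its value lies in the abelian group and is read from the
start, it factors out on the left.\<close>

lemma pump_once:
  assumes A: "subgroup A G" "comm_group (G\<lparr>carrier := A\<rparr>)"
    and U: "U \<in> M" "S \<subseteq> visited A U" and vl: "(v, l) \<in> loops A S n"
  shows "\<exists>U'\<in>M. S \<subseteq> visited A U' \<and> val U' = v \<otimes> val U \<and> length U' = l + length U"
proof -
  obtain p \<beta> where p: "p \<in> lists Y" "\<beta> \<in> lists Y" "vertex A p \<in> S"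
    "vertex A (p @ \<beta>) = vertex A p" "v = val p \<otimes> val \<beta> \<otimes> inv (val p)" "l = length \<beta>"
    using vl by (auto simp: loops_def)
  obtain t where t: "vertex A (take t U) = vertex A p"
    using U(2) p(3) by (auto simp: visited_def)
  let ?a = "take t U" and ?c = "drop t U"
  have lU: "?a \<in> lists Y" "?c \<in> lists Y" using U(1) by simp_all
  have ab: "vertex A (?a @ \<beta>) = vertex A ?a"
    using vertex_append[OF A(1) lU(1) p(1,2) t] p(4) t by simp
  have v: "v = val ?a \<otimes> val \<beta> \<otimes> inv (val ?a)"
    using loop_value(2)[OF A p(1) lU(1) p(2)] t p(4,5) by simp
  let ?U' = "?a @ \<beta> @ ?c"
  have "foldl \<delta> q\<^sub>0 ?U' = foldl \<delta> q\<^sub>0 (?a @ ?c)"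
    using ab by (simp only: vertex_def foldl_append prod.inject)
  then have "?U' \<in> M" using lU p(2) by (intro langI[OF U(1)]) simp_all
  moreover have "val ?U' = v \<otimes> val U"
    using v lU p(2) val_take_drop[of U t, symmetric] U(1) by (simp add: m_assoc inv_cancel)
  moreover have "length ?U' = l + length U" using p(6) by simp
  moreover have "S \<subseteq> visited A ?U'"
  proof
    fix x assume "x \<in> S"
    then obtain s where s: "x = vertex A (take s U)" using U(2) by (auto simp: visited_def)
    show "x \<in> visited A ?U'"
    proof (cases "s \<le> length ?a")
      case True
      then have "take s ?U' = take s U" by simp
      then show ?thesis using s unfolding visited_def by (metis rangeI)
    next
      case False
      then have "take s U = ?a @ take (s - length ?a) ?c"
        "take (s + length \<beta>) ?U' = (?a @ \<beta>) @ take (s - length ?a) ?c"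
        using take_insert_after(1)[of ?a s ?c] take_insert_after(2)[of ?a s \<beta> ?c]
        by (simp_all only: append_take_drop_id)
      moreover have "vertex A ((?a @ \<beta>) @ take (s - length ?a) ?c) = vertex A (?a @ take (s - length ?a) ?c)"
        using vertex_append[OF A(1), of "?a @ \<beta>" ?a] lU p(2) ab by simp
      ultimately show ?thesis using s unfolding visited_def by (metis rangeI)
    qed
  qed
  ultimately show ?thesis by blast
qed

lemma pump:
  assumes A: "subgroup A G" "comm_group (G\<lparr>carrier := A\<rparr>)"
    and U: "U \<in> M" "S \<subseteq> visited A U" and x: "(x, k) \<in> weighted_products G (loops A S n)"
  shows "\<exists>U'\<in>M. S \<subseteq> visited A U' \<and> val U' = x \<otimes> val U \<and> length U' \<le> k + length U"
  using x
proof (induction rule: weighted_products.induct)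
  case (slack k)
  show ?case using U by (intro bexI[of _ U]) auto
next
  case (factor x k v l)
  then obtain U' where U': "U' \<in> M" "S \<subseteq> visited A U'" "val U' = x \<otimes> val U" "length U' \<le> k + length U"
    by blast
  obtain U'' where U'': "U'' \<in> M" "S \<subseteq> visited A U''" "val U'' = v \<otimes> val U'" "length U'' = l + length U'"
    using pump_once[OF A U'(1,2) factor(2)] by blast
  have v: "v \<in> carrier G"
    using loops_subset[OF A] factor(2) subgroup.mem_carrier[OF A(1)] by auto
  have "x \<otimes> val U \<in> carrier G" "val U \<in> carrier G" using U' U by (metis lang_lists val_closed)+
  moreover have "x \<in> carrier G"
    using comm_group.weighted_products_closed[OF A(2), of "loops A S n" x k] factor(1)
      loops_subset[OF A, of S n] subgroup.mem_carrier[OF A(1)]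
    by (auto simp: weighted_products_carrier_update)
  ultimately show ?case using U' U'' v by (intro bexI[of _ U'']) (auto simp: m_assoc)
qed

text \<open>Erases a loop among the first \<open>card S\<close> steps as long as the word is long enough to have one. The set \<open>S\<close> is
fixed beforehand because the word that remains may visit fewer vertices.\<close>

lemma loop_erasure:
  assumes A: "subgroup A G" "comm_group (G\<lparr>carrier := A\<rparr>)" and S: "finite S"
    and U: "U \<in> lists Y" "visited A U \<subseteq> S"
  shows "\<exists>r x k. r \<in> lists Y \<and> length r < card S \<and> (x, k) \<in> weighted_products G (loops A S (card S)) \<and>
    val U = x \<otimes> val r \<and> length U = k + length r"
  using U
proof (induction "length U" arbitrary: U rule: less_induct)
  case less
  let ?n = "card S"
  show ?case
  proof (cases "length U < ?n")
    case True
    then show ?thesis using less.prems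
      by (intro exI[of _ U] exI[of _ \<one>] exI[of _ 0]) (auto intro: weighted_products.slack)
  next
    case False
    define f where "f t = vertex A (take t U)" for t
    have "f ` {..?n} \<subseteq> S" using less.prems(2) by (auto simp: f_def visited_def)
    then have "card (f ` {..?n}) < card {..?n}" using card_mono[OF S] by (metis card_atMost le_imp_less_Suc)
    then have "\<not> inj_on f {..?n}" by (rule pigeonhole)
    then obtain i j where ij: "i < j" "j \<le> ?n" "f i = f j"
      unfolding inj_on_def by (metis atMost_iff linorder_neqE_nat)
    define a b c where "a = take i U" and "b = drop i (take j U)" and "c = drop j U"
    have L: "a \<in> lists Y" "b \<in> lists Y" "c \<in> lists Y" using less.prems by (simp_all add: a_def b_def c_def)
    have ab: "take j U = a @ b" unfolding a_def b_def using ij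
      by (metis append_take_drop_id less_imp_le min.absorb1 take_take)
    have Ue: "U = a @ b @ c" using ab by (metis append.assoc append_take_drop_id c_def)
    have lb: "length b = j - i" "length a = i" using ij False by (simp_all add: a_def b_def)
    have vab: "vertex A (a @ b) = vertex A a" using ij(3) ab by (simp add: f_def a_def)
    have "visited A (a @ c) \<subseteq> S"
    proof
      fix x assume "x \<in> visited A (a @ c)"
      then obtain s where s: "x = vertex A (take s (a @ c))" by (auto simp: visited_def)
      have "\<exists>s'. x = vertex A (take s' U)"
      proof (cases "s \<le> length a")
        case True
        then show ?thesis using s Ue by (intro exI[of _ s]) simp
      next
        case False
        then have "take s (a @ c) = a @ take (s - length a) c"
          "take (s + length b) U = (a @ b) @ take (s - length a) c" using Ue by simp_all
        then show ?thesis using s vertex_append[OF A(1), of "a @ b" a] L vab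
          by (intro exI[of _ "s + length b"]) simp
      qed
      then show "x \<in> S" using less.prems(2) by (auto simp: visited_def)
    qed
    moreover have "length (a @ c) < length U" using Ue lb ij by simp
    ultimately obtain r x k where r: "r \<in> lists Y" "length r < ?n"
      "(x, k) \<in> weighted_products G (loops A S ?n)" "val (a @ c) = x \<otimes> val r" "length (a @ c) = k + length r"
      using less.hyps[of "a @ c"] L by auto
    define v where "v = val a \<otimes> val b \<otimes> inv (val a)"
    have "vertex A a \<in> S" using less.prems(2) unfolding a_def visited_def by auto
    then have vl: "(v, length b) \<in> loops A S ?n"
      unfolding loops_def v_def using L vab lb ij by force
    then have "v \<in> carrier G" using loops_subset[OF A] subgroup.mem_carrier[OF A(1)] by auto
    moreover have "x \<in> carrier G"
      using comm_group.weighted_products_closed[OF A(2), of "loops A S ?n" x k] r(3)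
        loops_subset[OF A, of S ?n] subgroup.mem_carrier[OF A(1)]
      by (auto simp: weighted_products_carrier_update)
    moreover have "val U = v \<otimes> val (a @ c)" unfolding Ue v_def using L by (simp add: m_assoc inv_cancel)
    ultimately have "val U = (v \<otimes> x) \<otimes> val r" using r by (simp add: m_assoc)
    moreover have "length U = (length b + k) + length r" using r(5) Ue by simp
    ultimately show ?thesis using r(1,2) weighted_products.factor[OF r(3) vl] by blast
  qed
qed

section \<open>Stable length\<close>

text \<open>A bound for the growth rate of the least length of accepted words for the powers of \<open>h\<close>.\<close>

definition stable_length_le :: "'a \<Rightarrow> nat \<Rightarrow> bool" where
  "stable_length_le h l \<longleftrightarrow> (\<exists>C. \<forall>k. \<exists>U\<in>M. val U = h [^] (k::nat) \<and> length U \<le> k * l + C)"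

lemma stable_length_conj:
  assumes g: "g \<in> carrier G" and h: "h \<in> carrier G" "stable_length_le h l"
  shows "stable_length_le (g \<otimes> h \<otimes> inv g) l"
proof -
  obtain C where C: "\<And>k. \<exists>U\<in>M. val U = h [^] (k::nat) \<and> length U \<le> k * l + C"
    using h(2) unfolding stable_length_le_def by blast
  obtain K where K: "\<And>V. V \<in> M \<Longrightarrow> \<exists>U\<in>M. val U = g \<otimes> val V \<otimes> inv g \<and> length U \<le> length V + K"
    using translation_length_bound[of g "inv g"] g by blast
  have "\<exists>U\<in>M. val U = (g \<otimes> h \<otimes> inv g) [^] k \<and> length U \<le> k * l + (C + K)" for k :: nat
  proof -
    obtain V where V: "V \<in> M" "val V = h [^] k" "length V \<le> k * l + C" using C by blast
    obtain U where "U \<in> M" "val U = g \<otimes> val V \<otimes> inv g" "length U \<le> length V + K" using K V(1) by blast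
    then show ?thesis using V conj_nat_pow[OF g h(1)] by (intro bexI[of _ U]) auto
  qed
  then show ?thesis unfolding stable_length_le_def by blast
qed

lemma stable_length_pow:
  assumes "h \<in> carrier G" "stable_length_le h l"
  shows "stable_length_le (h [^] (j::nat)) (j * l)"
proof -
  obtain C where C: "\<And>k. \<exists>U\<in>M. val U = h [^] (k::nat) \<and> length U \<le> k * l + C"
    using assms(2) unfolding stable_length_le_def by blast
  have "\<exists>U\<in>M. val U = (h [^] j) [^] k \<and> length U \<le> k * (j * l) + C" for k
    using C[of "j * k"] assms(1) by (simp add: nat_pow_pow mult_ac)
  then show ?thesis unfolding stable_length_le_def by blast
qed

lemma ex_stable_length:
  assumes h: "h \<in> carrier G"
  shows "\<exists>l. stable_length_le h l"
proof -
  obtain K where K: "\<And>V. V \<in> M \<Longrightarrow> \<exists>U\<in>M. val U = h \<otimes> val V \<otimes> \<one> \<and> length U \<le> length V + K"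
    using translation_length_bound[of h \<one>] h by blast
  obtain U0 where U0: "U0 \<in> M" "val U0 = \<one>" using ex_word by blast
  have "\<exists>U\<in>M. val U = h [^] k \<and> length U \<le> k * K + length U0" for k :: nat
  proof (induction k)
    case 0
    show ?case using U0 by auto
  next
    case (Suc k)
    then obtain V where V: "V \<in> M" "val V = h [^] k" "length V \<le> k * K + length U0" by blast
    obtain U where "U \<in> M" "val U = h \<otimes> val V \<otimes> \<one>" "length U \<le> length V + K" using K V(1) by blast
    then show ?case using V h nat_pow_Suc2[OF h, of k] by (intro bexI[of _ U]) auto
  qed
  then show ?thesis unfolding stable_length_le_def by blast
qed

text \<open>The set \<open>E\<close> spans the polytope that contains all points of stable length at most 1: its own points have this
property, and all the others are in their hull. For each set \<open>S\<close> of vertices that some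
accepted word visits, the loops in \<open>S\<close> generate a monoid, and \<open>E\<close> collects
generators of its part in \<open>H\<close>. Inserting loops into the word that visits \<open>S\<close> bounds the stable length of
a generator. Conversely, accepted words for the powers of \<open>h\<close> decompose into loops and a remainder of bounded
length; infinitely many of them have the same \<open>S\<close> and the same remainder, as \<open>in_cone_of_linear_growth\<close> requires.\<close>

lemma stable_length_cone:
  assumes A: "subgroup A G" "comm_group (G\<lparr>carrier := A\<rparr>)" "finite (prefix_cosets A)"
    and H: "subgroup H G" "H \<subseteq> A"
  shows "\<exists>E. finite E \<and> E \<subseteq> H \<times> {0<..} \<and> (\<forall>(u, l)\<in>E. stable_length_le u l) \<and>
    (\<forall>h\<in>H. \<forall>l. stable_length_le h l \<longrightarrow> in_cone G E h l)"
proof -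
  let ?A = "G\<lparr>carrier := A\<rparr>"
  interpret A: comm_group ?A by fact
  have HA: "subgroup H ?A" using H A(1) by (simp add: subgroup_incl)
  note Ac = subgroup.mem_carrier[OF A(1)]
  define \<V> where "\<V> = {visited A U |U. U \<in> M \<and> val U \<in> A}"
  define V0 where "V0 = Q \<times> prefix_cosets A"
  have V0: "finite V0" using A(3) finite_states by (simp add: V0_def)
  have vis: "visited A U \<subseteq> V0" if "U \<in> M" "val U \<in> A" for U
    using that run_closed by (force simp: visited_def vertex_def V0_def prefix_cosets_def)
  then have "\<V> \<subseteq> Pow V0" by (auto simp: \<V>_def)
  then have f\<V>: "finite \<V>" using V0 finite_subset by blast
  have fS: "finite S" if "S \<in> \<V>" for S using that \<open>\<V> \<subseteq> Pow V0\<close> finite_subset[OF _ V0] by blast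
  define J where "J S = loops A S (card S)" for S
  have J: "finite (J S)" "J S \<subseteq> A \<times> {0<..}" "J S \<subseteq> carrier ?A \<times> UNIV" if "S \<in> \<V>" for S
    using finite_loops[OF A(1,2) fS[OF that]] loops_subset[OF A(1,2)] by (force simp: J_def)+
  have "\<forall>S\<in>\<V>. \<exists>E. finite E \<and> E \<subseteq> weighted_products ?A (J S) \<and> E \<subseteq> H \<times> {0<..} \<and>
    (\<forall>x n. (x, n) \<in> weighted_products ?A (J S) \<longrightarrow> x \<in> H \<longrightarrow> (x, n) \<in> weighted_products ?A E)"
    using A.gordan[OF J(1) _ HA] J(2) by simp
  from bchoice[OF this] obtain E where
    "\<forall>S\<in>\<V>. finite (E S) \<and> E S \<subseteq> weighted_products ?A (J S) \<and> E S \<subseteq> H \<times> {0<..} \<and>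
      (\<forall>x n. (x, n) \<in> weighted_products ?A (J S) \<longrightarrow> x \<in> H \<longrightarrow> (x, n) \<in> weighted_products ?A (E S))"
    by (rule exE)
  then have E: "\<And>S. S \<in> \<V> \<Longrightarrow> finite (E S)"
    "\<And>S. S \<in> \<V> \<Longrightarrow> E S \<subseteq> weighted_products ?A (J S)" "\<And>S. S \<in> \<V> \<Longrightarrow> E S \<subseteq> H \<times> {0<..}"
    "\<And>S x n. S \<in> \<V> \<Longrightarrow> (x, n) \<in> weighted_products ?A (J S) \<Longrightarrow> x \<in> H \<Longrightarrow> (x, n) \<in> weighted_products ?A (E S)"
    by simp_all
  show ?thesis
  proof (intro exI[of _ "\<Union>S\<in>\<V>. E S"] conjI)
    show "finite (\<Union>S\<in>\<V>. E S)" using f\<V> E(1) by blast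
    show "(\<Union>S\<in>\<V>. E S) \<subseteq> H \<times> {0<..}" using E(3) by blast
    show "\<forall>(u, l)\<in>\<Union>S\<in>\<V>. E S. stable_length_le u l"
    proof clarify
      fix S u l assume S: "S \<in> \<V>" and ul: "(u, l) \<in> E S"
      obtain W where W: "W \<in> M" "val W \<in> A" "S = visited A W" using S by (auto simp: \<V>_def)
      have uc: "u \<in> carrier G" using E(3)[OF S] ul H(2) Ac by auto
      have c: "val W \<in> carrier G" using W by simp
      obtain K where K: "\<And>V. V \<in> M \<Longrightarrow> \<exists>U\<in>M. val U = \<one> \<otimes> val V \<otimes> inv (val W) \<and> length U \<le> length V + K"
        using translation_length_bound[of \<one> "inv (val W)"] c by blast
      have "\<exists>U\<in>M. val U = u [^] k \<and> length U \<le> k * l + (length W + K)" for k :: nat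
      proof -
        have "(u [^]\<^bsub>?A\<^esub> k, k * l) \<in> weighted_products ?A (J S)"
          using A.weighted_products_pow[OF J(3)[OF S]] E(2)[OF S] ul by blast
        then have "(u [^] k, k * l) \<in> weighted_products G (loops A S (card S))"
          by (simp add: weighted_products_carrier_update nat_pow_consistent[symmetric] J_def)
        then obtain V where V: "V \<in> M" "val V = u [^] k \<otimes> val W" "length V \<le> k * l + length W"
          using pump[OF A(1,2) W(1)] W(3) by blast
        obtain U where "U \<in> M" "val U = \<one> \<otimes> val V \<otimes> inv (val W)" "length U \<le> length V + K"
          using K[OF V(1)] by blast
        then show ?thesis using V c uc by (intro bexI[of _ U]) (auto simp: m_assoc)
      qed
      then show "stable_length_le u l" unfolding stable_length_le_def by blast
    qed
    show "\<forall>h\<in>H. \<forall>l. stable_length_le h l \<longrightarrow> in_cone G (\<Union>S\<in>\<V>. E S) h l"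
    proof (intro ballI allI impI)
      fix h l assume h: "h \<in> H" and "stable_length_le h l"
      then obtain C where C: "\<And>k. \<exists>U\<in>M. val U = h [^] (k::nat) \<and> length U \<le> k * l + C"
        unfolding stable_length_le_def by blast
      have hA: "h \<in> A" "h \<in> carrier G" using h H Ac by auto
      have pA: "h [^] k \<in> A" "h [^] k \<in> H" for k :: nat
        using subgroup_pow_closed hA h H A(1) by blast+
      obtain W where W: "\<And>k. W k \<in> M" "\<And>k. val (W k) = h [^] k" "\<And>k. length (W k) \<le> k * l + C"
        using C by metis
      define \<S> where "\<S> k = visited A (W k)" for k
      have \<S>: "\<S> k \<in> \<V>" for k using W pA by (auto simp: \<S>_def \<V>_def)
      have "\<exists>r x m. r \<in> lists Y \<and> length r < card (\<S> k) \<and> (x, m) \<in> weighted_products G (J (\<S> k)) \<and>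
        val (W k) = x \<otimes> val r \<and> length (W k) = m + length r" for k
        using loop_erasure[OF A(1,2) fS[OF \<S>]] W(1) unfolding J_def \<S>_def by auto
      then obtain r x m where r: "\<And>k. r k \<in> lists Y" "\<And>k. length (r k) < card (\<S> k)"
        "\<And>k. (x k, m k) \<in> weighted_products G (J (\<S> k))" "\<And>k. val (W k) = x k \<otimes> val (r k)"
        "\<And>k. length (W k) = m k + length (r k)" by metis
      \<comment> \<open>The data of the \<open>k\<close>-th word that range over a finite set, independent of \<open>k\<close>.\<close>
      define \<phi> where "\<phi> k = (\<S> k, r k)" for k
      have "\<phi> k \<in> \<V> \<times> {w. set w \<subseteq> Y \<and> length w \<le> card V0}" for k
      proof -
        have "card (\<S> k) \<le> card V0" using vis[OF W(1)] W(2) pA V0 card_mono by (metis \<S>_def)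
        then show ?thesis using \<S> r(1,2)[of k] by (auto simp: \<phi>_def)
      qed
      then have "range \<phi> \<subseteq> \<V> \<times> {w. set w \<subseteq> Y \<and> length w \<le> card V0}" by blast
      then have "finite (range \<phi>)"
        using f\<V> finite_lists_length_le[OF finite_alphabet] finite_subset by blast
      then obtain k0 where k0: "infinite {k. \<phi> k = \<phi> k0}"
        using pigeonhole_infinite[of UNIV \<phi>] by auto
      let ?S = "\<S> k0" and ?c = "val (r k0)"
      have Jc: "J ?S \<subseteq> carrier ?A \<times> UNIV" "finite (J ?S)" using J \<S> by blast+
      have cA: "?c \<in> A"
      proof -
        have "x k0 \<in> A" using A.weighted_products_closed[OF Jc(1)] r(3) by (fastforce simp: weighted_products_carrier_update)
        moreover have "?c = inv (x k0) \<otimes> h [^] k0"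
          using r(4)[of k0] W(2) calculation Ac r(1) by (simp add: inv_cancel)
        ultimately show ?thesis using pA A(1) by (simp add: subgroup.m_closed subgroup.m_inv_closed)
      qed
      have "in_cone ?A (J ?S) h l"
      proof (rule A.in_cone_of_linear_growth[OF Jc(2,1) _ _ k0, of h ?c l C])
        fix k assume "k \<in> {k. \<phi> k = \<phi> k0}"
        then have k: "\<S> k = ?S" "r k = r k0" by (auto simp: \<phi>_def)
        have "m k \<le> k * l + C" using W(3)[of k] r(5)[of k] by simp
        then obtain d where d: "k * l + C = d + m k" by (metis add.commute le_Suc_ex)
        have xk: "(x k, m k) \<in> weighted_products ?A (J ?S)"
          using r(3)[of k] k by (simp add: weighted_products_carrier_update)
        have "(\<one>\<^bsub>?A\<^esub> \<otimes>\<^bsub>?A\<^esub> x k, d + m k) \<in> weighted_products ?A (J ?S)"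
          by (rule A.weighted_products_mult[OF Jc(1) weighted_products.slack xk])
        then have "(x k, k * l + C) \<in> weighted_products ?A (J ?S)"
          using A.weighted_products_closed[OF Jc(1) xk] d by (metis A.l_one)
        moreover have "h [^]\<^bsub>?A\<^esub> k = x k \<otimes>\<^bsub>?A\<^esub> ?c"
          using r(4)[of k] W(2) k by (simp add: nat_pow_consistent[symmetric])
        ultimately show "\<exists>y. h [^]\<^bsub>?A\<^esub> k = y \<otimes>\<^bsub>?A\<^esub> ?c \<and> (y, k * l + C) \<in> weighted_products ?A (J ?S)"
          by blast
      qed (use hA cA in auto)
      then obtain k where k: "k > 0" "(h [^]\<^bsub>?A\<^esub> k, k * l) \<in> weighted_products ?A (J ?S)"
        unfolding in_cone_def by blast
      have "h [^]\<^bsub>?A\<^esub> k \<in> H" using pA by (simp add: nat_pow_consistent[symmetric])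
      then have "(h [^]\<^bsub>?A\<^esub> k, k * l) \<in> weighted_products ?A (E ?S)" using E(4)[OF \<S>] k by blast
      then have "(h [^] k, k * l) \<in> weighted_products G (E ?S)"
        by (simp add: weighted_products_carrier_update nat_pow_consistent[symmetric])
      then have "(h [^] k, k * l) \<in> weighted_products G (\<Union>S\<in>\<V>. E S)"
        by (rule weighted_products_mono) (use \<S> in auto)
      then show "in_cone G (\<Union>S\<in>\<V>. E S) h l" unfolding in_cone_def using k(1) by blast
    qed
  qed
qed

section \<open>The commensurator permutes the extreme points\<close>

lemma extremal_stable_lengths:
  assumes H: "subgroup H G" and K: "comm_group (G\<lparr>carrier := H\<rparr>)"
    and fg: "finitely_generated (G\<lparr>carrier := H\<rparr>)"
  shows "\<exists>W. finite W \<and> W \<subseteq> H \<times> {0<..} \<and> (\<forall>(w, l)\<in>W. stable_length_le w l) \<and>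
    (\<forall>(w, l)\<in>W. \<not> in_cone G (W - {(w, l)}) w l) \<and>
    (\<forall>h\<in>H. \<forall>l. stable_length_le h l \<longrightarrow> in_cone G W h l)"
proof -
  interpret K: comm_group "G\<lparr>carrier := H\<rparr>" by fact
  obtain X where X: "finite X" "X \<subseteq> H" "generate (G\<lparr>carrier := H\<rparr>) X = H"
    using fg unfolding finitely_generated_def by auto
  have "H \<subseteq> generate G X" using generate_consistent[OF X(2) H] X(3) by simp
  moreover have "x \<otimes> y = y \<otimes> x" if "x \<in> H" "y \<in> H" for x y using K.m_comm that by simp
  ultimately obtain A where A: "subgroup A G" "comm_group (G\<lparr>carrier := A\<rparr>)" "H \<subseteq> A" "finite (prefix_cosets A)"
    using abelian_overgroup[OF H _ X(1,2)] by blast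
  obtain E where E: "finite E" "E \<subseteq> H \<times> {0<..}" "\<forall>(u, l)\<in>E. stable_length_le u l"
    "\<forall>h\<in>H. \<forall>l. stable_length_le h l \<longrightarrow> in_cone G E h l"
    using stable_length_cone[OF A(1,2,4) H A(3)] by blast
  have Ec: "E \<subseteq> carrier (G\<lparr>carrier := H\<rparr>) \<times> UNIV" using E(2) by auto
  obtain W where W: "W \<subseteq> E" "\<forall>(u, l)\<in>E. in_cone G W u l" "\<forall>(w, l)\<in>W. \<not> in_cone G (W - {(w, l)}) w l"
    using K.irredundant_subset[OF E(1) Ec] unfolding in_cone_carrier_update by blast
  have Wc: "W \<subseteq> carrier (G\<lparr>carrier := H\<rparr>) \<times> UNIV" using W(1) Ec by blast
  have "in_cone G W h l" if "h \<in> H" "stable_length_le h l" for h l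
    using K.in_cone_trans[OF Wc E(1) Ec, of h l] W(2) E(4) that unfolding in_cone_carrier_update by auto
  moreover have "finite W" "W \<subseteq> H \<times> {0<..}" "\<forall>(w, l)\<in>W. stable_length_le w l"
    using W(1) E finite_subset by blast+
  ultimately show ?thesis using W(3) by (intro exI[of _ W]) simp
qed

text \<open>Both \<open>g\<close> and its inverse preserve stable length and so the polytope. Write the image of a vertex under \<open>g\<close> as
a convex combination, with a vertex \<open>w'\<close> contributing to it. Applying the inverse displays the original vertex as
a convex combination to which the preimage of \<open>w'\<close> contributes; being extreme, the vertex is this preimage.\<close>

lemma commensurator_permutes_extremal:
  assumes H: "subgroup H G" and K: "comm_group (G\<lparr>carrier := H\<rparr>)"
    and W: "finite W" "W \<subseteq> H \<times> {0<..}" "\<And>w l. (w, l) \<in> W \<Longrightarrow> stable_length_le w l"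
    and irr: "\<And>w l. (w, l) \<in> W \<Longrightarrow> \<not> in_cone G (W - {(w, l)}) w l"
    and cone: "\<And>h l. h \<in> H \<Longrightarrow> stable_length_le h l \<Longrightarrow> in_cone G W h l"
    and g: "g \<in> commensurator G H" and w: "(w, l) \<in> W"
  shows "\<exists>w' l'. (w', l') \<in> W \<and>
    (\<exists>i>0. \<exists>j>0. g \<otimes> w [^] (i::nat) \<otimes> inv g = w' [^] (j::nat) \<and> i * l = j * l')"
proof -
  let ?K = "G\<lparr>carrier := H\<rparr>"
  interpret K: comm_group ?K by fact
  note Hc = subgroup.mem_carrier[OF H]
  have pow: "x [^]\<^bsub>?K\<^esub> n = x [^] n" for x and n :: nat by (simp add: nat_pow_consistent[symmetric])
  have gc: "g \<in> carrier G" using g by (simp add: commensurator_def)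
  have Wc: "W \<subseteq> carrier ?K \<times> UNIV" "W \<subseteq> carrier ?K \<times> {0<..}" using W(2) by auto
  have wc: "x \<in> carrier G" "x \<in> H" "n > 0" if "(x, n) \<in> W" for x n using that W(2) Hc by auto
  have wpc: "x \<in> H" if "(x, n) \<in> weighted_products G W" for x n
    using K.weighted_products_closed[OF Wc(1)] that by (simp add: weighted_products_carrier_update)
  have conj_in: "\<exists>k>0. (a \<otimes> x [^] (k::nat) \<otimes> inv a, k * n) \<in> weighted_products G W"
    if a: "a \<in> commensurator G H" and x: "(x, n) \<in> W" for a x n
  proof -
    have ac: "a \<in> carrier G" using a by (simp add: commensurator_def)
    have "finite_index (H \<inter> conj_set G (inv a) H) ?K" using a by (simp add: commensurator_def)
    then obtain j where j: "j > 0" "x [^] (j::nat) \<in> conj_set G (inv a) H"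
      using K.finite_index_power[of "H \<inter> conj_set G (inv a) H" x] wc[OF x] by (auto simp: pow)
    define z where "z = a \<otimes> x [^] j \<otimes> inv a"
    have z: "z \<in> H" using j(2) ac by (simp add: conj_set_iff[OF H] z_def)
    have "stable_length_le z (j * n)"
      unfolding z_def using ac wc[OF x] W(3)[OF x] by (intro stable_length_conj stable_length_pow) auto
    then obtain k where k: "k > 0" "(z [^] (k::nat), k * (j * n)) \<in> weighted_products G W"
      using cone[OF z] unfolding in_cone_def by blast
    have "z [^] k = a \<otimes> x [^] (j * k) \<otimes> inv a"
      unfolding z_def using ac wc[OF x] by (simp add: conj_nat_pow nat_pow_pow)
    then show ?thesis using k j by (intro exI[of _ "j * k"]) (auto simp: mult_ac)
  qed
  have ig: "inv g \<in> commensurator G H"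
    using subgroup.m_inv_closed[OF commensurator_subgroup[OF H] g] .
  \<comment> \<open>One exponent for all vertices is needed to take the preimage of a whole product.\<close>
  have "\<exists>r>0. \<forall>p\<in>W. (inv g \<otimes> fst p [^] (r::nat) \<otimes> g, r * snd p) \<in> weighted_products G W"
  proof (rule common_multiple[OF W(1)])
    show "\<exists>k>0. (inv g \<otimes> fst p [^] (k::nat) \<otimes> g, k * snd p) \<in> weighted_products G W" if "p \<in> W" for p
      using conj_in[OF ig, of "fst p" "snd p"] that gc by simp
    show "(inv g \<otimes> fst p [^] (k * m) \<otimes> g, k * m * snd p) \<in> weighted_products G W"
      if p: "p \<in> W" "(inv g \<otimes> fst p [^] k \<otimes> g, k * snd p) \<in> weighted_products G W" for p and k m :: nat
    proof -
      have "fst p \<in> carrier G" using wc[of "fst p" "snd p"] p by simp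
      then have "(inv g \<otimes> fst p [^] k \<otimes> g) [^] m = inv g \<otimes> fst p [^] (k * m) \<otimes> g"
        using conj_nat_pow[of "inv g" "fst p [^] k" m] gc by (simp add: nat_pow_pow)
      then show ?thesis
        using K.weighted_products_pow[OF Wc(1), of _ _ m] p(2)
        by (metis mult.assoc mult.commute pow weighted_products_carrier_update)
    qed
  qed
  then obtain r where r0: "r > 0"
    "\<forall>p\<in>W. (inv g \<otimes> fst p [^] (r::nat) \<otimes> g, r * snd p) \<in> weighted_products G W"
    by blast
  have r: "(inv g \<otimes> x [^] r \<otimes> g, r * n) \<in> weighted_products G W" if "(x, n) \<in> W" for x n
    using bspec[OF r0(2) that] by simp
  have conj_back: "(inv g \<otimes> x [^] r \<otimes> g, r * n) \<in> weighted_products G W"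
    if "(x, n) \<in> weighted_products G W" for x n
    using that
  proof (induction rule: weighted_products.induct)
    case (slack n)
    show ?case using weighted_products.slack[of G "r * n" W] gc by simp
  next
    case (factor x n v m)
    have v: "v \<in> H" "v \<in> carrier G" and x: "x \<in> H" "x \<in> carrier G"
      using wc[OF factor(2)] wpc[OF factor(1)] Hc by auto
    have "(v \<otimes> x) [^] r = v [^] r \<otimes> x [^] r" using K.nat_pow_distrib[of v x r] v x by (simp add: pow)
    then have "inv g \<otimes> (v \<otimes> x) [^] r \<otimes> g = (inv g \<otimes> v [^] r \<otimes> g) \<otimes> (inv g \<otimes> x [^] r \<otimes> g)"
      using v x gc by (simp add: m_assoc inv_cancel)
    moreover have "((inv g \<otimes> v [^] r \<otimes> g) \<otimes> (inv g \<otimes> x [^] r \<otimes> g), r * m + r * n) \<in> weighted_products G W"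
      using K.weighted_products_mult[OF Wc(1)] r[OF factor(2)] factor(3)
      by (simp add: weighted_products_carrier_update)
    ultimately show ?case by (simp add: algebra_simps)
  qed
  obtain k where k: "k > 0" "(g \<otimes> w [^] (k::nat) \<otimes> inv g, k * l) \<in> weighted_products G W"
    using conj_in[OF g w] by blast
  note wG = wc(1)[OF w]
  from k(2) show ?thesis
  proof (cases rule: weighted_products.cases)
    case slack
    \<comment> \<open>An image that is a pure slack term is the origin; then \<open>w\<close> would be a torsion element, and redundant.\<close>
    have "w [^] k = inv g \<otimes> (g \<otimes> w [^] k \<otimes> inv g) \<otimes> g" using wG gc by (simp add: m_assoc inv_cancel)
    then have "w [^] k = \<one>" using slack gc by simp
    then have "in_cone G (W - {(w, l)}) w l"
      unfolding in_cone_def using k(1) weighted_products.slack by (intro exI[of _ k]) simp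
    then show ?thesis using irr[OF w] by simp
  next
    case (factor x n w' l')
    have w': "w' \<in> H" "w' \<in> carrier G" and x: "x \<in> H" "x \<in> carrier G"
      using wc[OF factor(4)] wpc[OF factor(3)] Hc by auto
    let ?a = "inv g \<otimes> w' [^] r \<otimes> g" and ?b = "inv g \<otimes> x [^] r \<otimes> g"
    have "?a \<otimes> ?b = inv g \<otimes> (w' \<otimes> x) [^] r \<otimes> g"
      using K.nat_pow_distrib[of w' x r] w' x gc by (simp add: pow m_assoc inv_cancel)
    also have "(w' \<otimes> x) [^] r = g \<otimes> w [^] (k * r) \<otimes> inv g"
      unfolding factor(1)[symmetric] using wG gc by (simp add: conj_nat_pow nat_pow_pow)
    also have "inv g \<otimes> (g \<otimes> w [^] (k * r) \<otimes> inv g) \<otimes> g = w [^] (k * r)"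
      using wG gc by (simp add: m_assoc inv_cancel)
    finally have ab: "?a \<otimes> ?b = w [^] (k * r)" .
    \<comment> \<open>The preimages of \<open>w'\<close> and of the rest of the product multiply to a power of \<open>w\<close>, with matching weights.\<close>
    have wt: "r * l' + r * n = (k * r) * l" using factor(2) by (metis distrib_left mult.assoc mult.commute)
    have "\<exists>i. ?a = w [^]\<^bsub>?K\<^esub> (i::nat) \<and> r * l' = i * l"
    proof (rule K.irredundant_face[OF Wc(2) _ w])
      show "\<not> in_cone ?K (W - {(w, l)}) w l" using irr[OF w] by (simp add: in_cone_carrier_update)
      show "(?a, r * l') \<in> weighted_products ?K W" "(?b, r * n) \<in> weighted_products ?K W"
        using r[OF factor(4)] conj_back[OF factor(3)] by (simp_all add: weighted_products_carrier_update)
      show "?a \<otimes>\<^bsub>?K\<^esub> ?b = w [^]\<^bsub>?K\<^esub> (k * r)" using ab by (simp add: pow)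
    qed (rule wt)
    then obtain i where i: "?a = w [^] (i::nat)" "r * l' = i * l" by (auto simp: pow)
    have "g \<otimes> w [^] i \<otimes> inv g = w' [^] r"
      unfolding i(1)[symmetric] using w' gc by (simp add: m_assoc inv_cancel)
    moreover have "i > 0" using i(2) r0(1) wc(3)[OF factor(4)] by (metis gr0I mult_eq_0_iff not_gr_zero)
    ultimately have "(w', l') \<in> W \<and> (\<exists>i>0. \<exists>j>0. g \<otimes> w [^] (i::nat) \<otimes> inv g = w' [^] (j::nat) \<and> i * l = j * l')"
      using i(2) r0(1) factor(4) by (intro conjI exI[of _ i] exI[of _ r]) simp_all
    then show ?thesis by (intro exI)
  qed
qed

text \<open>An element of the commensurator is determined, on a finite-index subgroup, by the permutation that it
induces on the vertices, because the equation \<open>i * l = j * l'\<close> fixes the ratio of the two exponents. There are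
finitely many permutations.\<close>

lemma finite_image_canonical_map:
  assumes H: "subgroup H G" and K: "comm_group (G\<lparr>carrier := H\<rparr>)"
    and fg: "finitely_generated (G\<lparr>carrier := H\<rparr>)"
  shows "finite (canonical_map G H ` commensurator G H)"
proof -
  let ?K = "G\<lparr>carrier := H\<rparr>"
  interpret K: comm_group ?K by fact
  note Hc = subgroup.mem_carrier[OF H]
  have pow: "x [^]\<^bsub>?K\<^esub> n = x [^] n" for x and n :: nat by (simp add: nat_pow_consistent[symmetric])
  obtain W where W0: "finite W" "W \<subseteq> H \<times> {0<..}" "\<forall>(w, l)\<in>W. stable_length_le w l"
    "\<forall>(w, l)\<in>W. \<not> in_cone G (W - {(w, l)}) w l"
    "\<forall>h\<in>H. \<forall>l. stable_length_le h l \<longrightarrow> in_cone G W h l"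
    using extremal_stable_lengths[OF assms] by blast
  then have W: "finite W" "W \<subseteq> H \<times> {0<..}" "\<And>w l. (w, l) \<in> W \<Longrightarrow> stable_length_le w l"
    "\<And>w l. (w, l) \<in> W \<Longrightarrow> \<not> in_cone G (W - {(w, l)}) w l"
    "\<And>h l. h \<in> H \<Longrightarrow> stable_length_le h l \<Longrightarrow> in_cone G W h l"
    by blast+
  have wc: "w \<in> carrier G" "w \<in> H" "l > 0" if "(w, l) \<in> W" for w l using that W(2) Hc by auto
  define R where "R g p q \<longleftrightarrow> q \<in> W \<and> (\<exists>i>0. \<exists>j>0. g \<otimes> fst p [^] (i::nat) \<otimes> inv g = fst q [^] (j::nat) \<and>
     i * snd p = j * snd q)" for g and p q :: "'a \<times> nat"
  define f where "f g = restrict (\<lambda>p. SOME q. R g p q) W" for g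
  have R: "R g p (f g p)" if "g \<in> commensurator G H" "p \<in> W" for g p
  proof -
    have "\<exists>q. R g p q"
      using commensurator_permutes_extremal[OF H K W that(1), of "fst p" "snd p"] that(2)
      unfolding R_def by fastforce
    then show ?thesis using that(2) by (simp add: f_def someI_ex)
  qed
  have "f ` commensurator G H \<subseteq> Pi\<^sub>E W (\<lambda>_. W)"
  proof clarify
    fix g assume "g \<in> commensurator G H"
    then have "f g p \<in> W" if "p \<in> W" for p using R that unfolding R_def by blast
    then show "f g \<in> Pi\<^sub>E W (\<lambda>_. W)" by (auto simp: f_def)
  qed
  then have "finite (f ` commensurator G H)" using W(1) by (meson finite_PiE finite_subset)
  then show ?thesis
  proof (rule finite_image_if_determined)
    fix g g' assume g: "g \<in> commensurator G H" "g' \<in> commensurator G H" and eq: "f g = f g'"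
    have gc: "g \<in> carrier G" "g' \<in> carrier G" using g by (auto simp: commensurator_def)
    define D where "D = {h \<in> H. g \<otimes> h \<otimes> inv g = g' \<otimes> h \<otimes> inv g'}"
    have DH: "D \<subseteq> H" by (auto simp: D_def)
    have hom: "a \<otimes> (x \<otimes> y) \<otimes> inv a = (a \<otimes> x \<otimes> inv a) \<otimes> (a \<otimes> y \<otimes> inv a)"
      if "a \<in> carrier G" "x \<in> carrier G" "y \<in> carrier G" for a x y
      using that by (simp add: m_assoc inv_cancel)
    have hom_inv: "a \<otimes> inv x \<otimes> inv a = inv (a \<otimes> x \<otimes> inv a)"
      if "a \<in> carrier G" "x \<in> carrier G" for a x
      using that by (simp add: m_assoc inv_mult_group)
    have "subgroup D G"
    proof (rule subgroup.intro)
      show "x \<otimes> y \<in> D" if "x \<in> D" "y \<in> D" for x y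
        using that gc Hc subgroup.m_closed[OF H] unfolding D_def by (simp add: hom)
      show "inv x \<in> D" if "x \<in> D" for x
        using that gc Hc subgroup.m_inv_closed[OF H] unfolding D_def by (simp add: hom_inv)
    qed (use DH Hc gc subgroup.one_closed[OF H] in \<open>auto simp: D_def\<close>)
    then have sD: "subgroup D ?K" using subgroup_incl H DH by blast
    have Dpow: "x [^] (n::nat) \<in> D" if "x \<in> D" for x n
      using subgroup_pow_closed[OF \<open>subgroup D G\<close> that] .
    have "\<exists>s>0. \<forall>p\<in>W. fst p [^] (s::nat) \<in> D"
    proof (rule common_multiple[OF W(1)])
      fix p assume p: "p \<in> W"
      have c: "fst p \<in> carrier G" "fst p \<in> H" "snd p > 0" using wc[of "fst p" "snd p"] p by auto
      have Rg: "R g p (f g p)" and Rg': "R g' p (f g p)" using R[OF g(1) p] R[OF g(2) p] eq by auto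
      define q where "q = f g p"
      have qW: "fst q \<in> carrier G" "snd q > 0"
        using Rg wc[of "fst q" "snd q"] by (auto simp: R_def q_def)
      obtain i j where ij: "i > 0" "g \<otimes> fst p [^] (i::nat) \<otimes> inv g = fst q [^] (j::nat)" "i * snd p = j * snd q"
        using Rg unfolding R_def q_def by blast
      obtain i' j' where ij': "j' > 0" "g' \<otimes> fst p [^] (i'::nat) \<otimes> inv g' = fst q [^] (j'::nat)" "i' * snd p = j' * snd q"
        using Rg' unfolding R_def q_def by blast
      have "(i * j') * (snd p * snd q) = (i' * j) * (snd p * snd q)"
        using ij(3) ij'(3) by (metis mult.assoc mult.commute)
      then have e: "i * j' = i' * j" using c(3) qW(2) by simp
      have "g \<otimes> fst p [^] (i * j') \<otimes> inv g = fst q [^] (j * j')"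
        using conj_nat_pow[OF gc(1), of "fst p [^] i" j'] ij(2) c qW(1) by (simp add: nat_pow_pow)
      moreover have "g' \<otimes> fst p [^] (i' * j) \<otimes> inv g' = fst q [^] (j' * j)"
        using conj_nat_pow[OF gc(2), of "fst p [^] i'" j] ij'(2) c qW(1) by (simp add: nat_pow_pow)
      ultimately have "fst p [^] (i * j') \<in> D"
        unfolding D_def using subgroup_pow_closed[OF H c(2)] by (simp add: e mult.commute)
      then show "\<exists>s>0. fst p [^] (s::nat) \<in> D" using ij(1) ij'(1) by (intro exI[of _ "i * j'"]) simp
      show "fst p [^] (s * m) \<in> D" if "fst p [^] s \<in> D" for s m :: nat
        using Dpow[OF that, of m] c(1) by (simp add: nat_pow_pow)
    qed
    then obtain s where s: "s > 0" "\<forall>p\<in>W. fst p [^] (s::nat) \<in> D" by blast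
    have Wc: "W \<subseteq> carrier ?K \<times> UNIV" using W(2) by auto
    have wpD: "x [^] s \<in> D" if "(x, n) \<in> weighted_products G W" for x n
      using that
    proof (induction rule: weighted_products.induct)
      case (slack n)
      show ?case using subgroup.one_closed[OF \<open>subgroup D G\<close>] by simp
    next
      case (factor x n w l)
      have "x \<in> H" using K.weighted_products_closed[OF Wc] factor(1)
        by (simp add: weighted_products_carrier_update)
      then have "(w \<otimes> x) [^] s = w [^] s \<otimes> x [^] s"
        using K.nat_pow_distrib[of w x s] wc[OF factor(2)] by (simp add: pow)
      then show ?case
        using bspec[OF s(2) factor(2)] factor(3) subgroup.m_closed[OF \<open>subgroup D G\<close>] by simp
    qed
    have tors: "\<exists>k>0. h [^]\<^bsub>?K\<^esub> (k::nat) \<in> D" if "h \<in> carrier ?K" for h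
    proof -
      have h: "h \<in> H" "h \<in> carrier G" using that Hc by auto
      obtain l where "stable_length_le h l" using ex_stable_length[OF h(2)] by blast
      then obtain k where k: "k > 0" "(h [^] (k::nat), k * l) \<in> weighted_products G W"
        using W(5)[OF h(1)] unfolding in_cone_def by blast
      have "h [^] (k * s) \<in> D" using wpD[OF k(2)] h(2) by (simp add: nat_pow_pow)
      then show ?thesis using k(1) s(1) by (intro exI[of _ "k * s"]) (simp add: pow)
    qed
    obtain X where X: "finite X" "X \<subseteq> carrier ?K" "generate ?K X = carrier ?K"
      using fg unfolding finitely_generated_def by blast
    have fD: "finite_index D ?K" by (rule K.finite_index_of_torsion_quotient[OF X sD tors])
    note gi = conj_iso_in[OF H g(1)] and gi' = conj_iso_in[OF H g(2)]
    let ?C = "D \<inter> ((H \<inter> conj_set G (inv g) H) \<inter> (H \<inter> conj_set G (inv g') H))"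
    have "finite_index ?C ?K"
      using g by (intro K.finite_index_Int[OF fD K.finite_index_Int]) (auto simp: commensurator_def)
    then show "canonical_map G H g = canonical_map G H g'"
      unfolding canonical_map_def conj_iso_def
      by (intro K.class_eqI[OF gi[unfolded conj_iso_def] gi'[unfolded conj_iso_def]])
        (auto simp: D_def)
  qed
qed

end

section \<open>From the biautomatic structure to the commensurator\<close>

text \<open>The elements of bounded word length are finite in number, as the alphabet is finite.\<close>

lemma biautomatic_structure_imp_automaton:
  assumes "group G" and bi: "biautomatic_structure G Y \<iota> M"
  shows "\<exists>Q q\<^sub>0 \<delta> F. biautomatic_group G Y \<iota> M Q q\<^sub>0 \<delta> F"
proof -
  interpret group G by fact
  have alph: "finite Y" "\<iota> ` Y \<subseteq> carrier G" "\<one>\<^bsub>G\<^esub> \<in> \<iota> ` Y"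
    and M: "M \<subseteq> lists Y" "word_val G \<iota> ` M = carrier G"
    and reg: "regular_language Y M" and ft: "two_sided_fellow_traveller G Y \<iota> M"
    using bi by (auto simp: biautomatic_structure_def generating_alphabet_def)
  have vc: "word_val G \<iota> w \<in> carrier G" if "w \<in> lists Y" for w
    using that by (induction w) (use alph in \<open>auto simp: word_val_def\<close>)
  obtain Q q\<^sub>0 \<delta> F where aut: "finite (Q :: nat set)" "q\<^sub>0 \<in> Q" "\<forall>q\<in>Q. \<forall>y\<in>Y. \<delta> q y \<in> Q"
    "M = {w \<in> lists Y. foldl \<delta> q\<^sub>0 w \<in> F}"
    using reg unfolding regular_language_def by auto
  obtain L :: real where L: "\<forall>U\<in>M. \<forall>V\<in>M. \<forall>x\<in>Y. \<forall>y\<in>Y. word_val G \<iota> U = word_val G \<iota> (x # V @ [y]) \<longrightarrow>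
     (\<forall>t::nat. real (word_length G Y \<iota>
        (inv\<^bsub>G\<^esub> (word_val G \<iota> (take t U)) \<otimes>\<^bsub>G\<^esub> \<iota> x \<otimes>\<^bsub>G\<^esub> word_val G \<iota> (take t V))) \<le> L)"
    using ft unfolding two_sided_fellow_traveller_def by auto
  define B where "B = word_val G \<iota> ` {w. set w \<subseteq> Y \<and> length w \<le> nat \<lfloor>L\<rfloor>}"
  have ball: "g \<in> B" if g: "g \<in> carrier G" "real (word_length G Y \<iota> g) \<le> L" for g
  proof -
    obtain u where "u \<in> lists Y" "word_val G \<iota> u = g" using M g(1) by (metis image_iff subsetD)
    then have "\<exists>n. \<exists>w\<in>lists Y. length w = n \<and> word_val G \<iota> w = g" by blast
    then have "\<exists>w\<in>lists Y. length w = word_length G Y \<iota> g \<and> word_val G \<iota> w = g"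
      unfolding word_length_def by (rule LeastI_ex)
    then obtain w where w: "w \<in> lists Y" "length w = word_length G Y \<iota> g" "word_val G \<iota> w = g" by blast
    have "length w \<le> nat \<lfloor>L\<rfloor>" using g(2) w(2) by (simp add: le_nat_iff le_floor_iff)
    then show ?thesis using w unfolding B_def by auto
  qed
  have finB: "finite B" unfolding B_def using finite_lists_length_le[OF alph(1)] by blast
  have inB: "inv\<^bsub>G\<^esub> (word_val G \<iota> (take t U)) \<otimes>\<^bsub>G\<^esub> \<iota> x \<otimes>\<^bsub>G\<^esub> word_val G \<iota> (take t V) \<in> B"
    if "U \<in> M" "V \<in> M" "x \<in> Y" "y \<in> Y" "word_val G \<iota> U = word_val G \<iota> (x # V @ [y])" for U V x y t
  proof (rule ball)
    have "take t U \<in> lists Y" "take t V \<in> lists Y"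
      using that(1,2) M(1) by (meson in_listsD in_listsI in_set_takeD subsetD)+
    then show "inv\<^bsub>G\<^esub> (word_val G \<iota> (take t U)) \<otimes>\<^bsub>G\<^esub> \<iota> x \<otimes>\<^bsub>G\<^esub> word_val G \<iota> (take t V) \<in> carrier G"
      using vc[of "take t U"] vc[of "take t V"] that(3) alph(2) by auto
  qed (use L that in blast)
  have fellow: "\<exists>B. finite B \<and> (\<forall>U\<in>M. \<forall>V\<in>M. \<forall>x\<in>Y. \<forall>y\<in>Y.
      word_val G \<iota> U = word_val G \<iota> (x # V @ [y]) \<longrightarrow>
      (\<forall>t. inv\<^bsub>G\<^esub> (word_val G \<iota> (take t U)) \<otimes>\<^bsub>G\<^esub> \<iota> x \<otimes>\<^bsub>G\<^esub> word_val G \<iota> (take t V) \<in> B))"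
    by (intro exI[of _ B] conjI ballI impI allI finB) (rule inB)
  have "biautomatic_group G Y \<iota> M Q q\<^sub>0 \<delta> F"
    by unfold_locales (fact alph aut M fellow aut(3)[rule_format])+
  then show ?thesis by blast
qed

text \<open>The class of \<open>g\<close> is trivial if and only if conjugation by \<open>g\<close> is the identity on a finite-index subgroup.\<close>

lemma kernel_canonical_map_centralises:
  assumes "group G" and H: "subgroup H G" and g: "g \<in> commensurator G H"
    and triv: "canonical_map G H g = \<one>\<^bsub>abstract_commensurator (G\<lparr>carrier := H\<rparr>)\<^esub>"
  shows "\<exists>K. finite_index K (G\<lparr>carrier := H\<rparr>) \<and> (\<forall>k\<in>K. g \<otimes>\<^bsub>G\<^esub> k = k \<otimes>\<^bsub>G\<^esub> g)"
proof -
  interpret group G by fact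
  let ?K = "G\<lparr>carrier := H\<rparr>"
  interpret K: group ?K by (rule subgroup_imp_group[OF H])
  note Hc = subgroup.mem_carrier[OF H]
  have gc: "g \<in> carrier G" using g by (simp add: commensurator_def)
  have "comm_rel ?K `` {conj_iso G H g} = comm_rel ?K `` {(H, H, restrict (\<lambda>h. h) H)}"
    using triv by (simp add: canonical_map_def abstract_commensurator_def comm_class_def)
  moreover have "(H, H, restrict (\<lambda>h. h) H) \<in> fi_isos ?K" using K.pid_in by simp
  ultimately have "(conj_iso G H g, (H, H, restrict (\<lambda>h. h) H)) \<in> comm_rel ?K"
    using eq_equiv_class[OF _ K.equiv_comm_rel] by metis
  then obtain C where C: "finite_index C ?K" "C \<subseteq> (H \<inter> conj_set G (inv\<^bsub>G\<^esub> g) H) \<inter> H"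
    "\<forall>h\<in>C. restrict (\<lambda>h. g \<otimes>\<^bsub>G\<^esub> h \<otimes>\<^bsub>G\<^esub> inv\<^bsub>G\<^esub> g) (H \<inter> conj_set G (inv\<^bsub>G\<^esub> g) H) h = restrict (\<lambda>h. h) H h"
    unfolding conj_iso_def K.comm_rel_iff by blast
  have "g \<otimes>\<^bsub>G\<^esub> k = k \<otimes>\<^bsub>G\<^esub> g" if k: "k \<in> C" for k
  proof -
    have kH: "k \<in> H" "k \<in> conj_set G (inv\<^bsub>G\<^esub> g) H" using C(2) k by auto
    then have kc: "k \<in> carrier G" using Hc by simp
    have "g \<otimes>\<^bsub>G\<^esub> k \<otimes>\<^bsub>G\<^esub> inv\<^bsub>G\<^esub> g = k" using C(3) k kH by fastforce
    then show ?thesis using kc gc by (metis inv_solve_right m_closed)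
  qed
  then show ?thesis using C(1) by blast
qed

theorem theorem1p2:
  fixes G :: "('a, 'b) monoid_scheme" and H :: "'a set"
  assumes "group G" and "biautomatic G"
    and "subgroup H G"
    and "finitely_generated (G\<lparr>carrier := H\<rparr>)"
    and "comm_group (G\<lparr>carrier := H\<rparr>)"
  shows "finite (canonical_map G H ` commensurator G H) \<and>
    (\<exists>N. N \<lhd> G\<lparr>carrier := commensurator G H\<rparr> \<and>
       finite_index N (G\<lparr>carrier := commensurator G H\<rparr>) \<and>
       (\<forall>g\<in>N. \<exists>K. finite_index K (G\<lparr>carrier := H\<rparr>) \<and>
          (\<forall>k\<in>K. g \<otimes>\<^bsub>G\<^esub> k = k \<otimes>\<^bsub>G\<^esub> g)))"
proof -
  interpret group G by fact
  obtain Y :: "nat set" and \<iota> M where "biautomatic_structure G Y \<iota> M"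
    using assms(2) unfolding biautomatic_def by blast
  then obtain Q q\<^sub>0 \<delta> F where bi: "biautomatic_group G Y \<iota> M Q q\<^sub>0 \<delta> F"
    using biautomatic_structure_imp_automaton[OF assms(1)] by blast
  have fin: "finite (canonical_map G H ` commensurator G H)"
    by (rule biautomatic_group.finite_image_canonical_map[OF bi assms(3,5,4)])
  let ?C = "G\<lparr>carrier := commensurator G H\<rparr>" and ?L = "abstract_commensurator (G\<lparr>carrier := H\<rparr>)"
  have "group ?C" by (rule subgroup_imp_group[OF commensurator_subgroup[OF assms(3)]])
  moreover have "group ?L"
    by (rule group.group_abstract_commensurator[OF subgroup_imp_group[OF assms(3)]])
  ultimately interpret c: group_hom ?C ?L "canonical_map G H"
    using canonical_map_hom[OF assms(3)] by (simp add: group_hom_def group_hom_axioms_def)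
  let ?N = "kernel ?C ?L (canonical_map G H)"
  have "finite_index ?N ?C" using fin by (intro c.finite_index_kernel) simp
  moreover have "\<exists>K. finite_index K (G\<lparr>carrier := H\<rparr>) \<and> (\<forall>k\<in>K. g \<otimes>\<^bsub>G\<^esub> k = k \<otimes>\<^bsub>G\<^esub> g)"
    if "g \<in> ?N" for g
    using kernel_canonical_map_centralises[OF assms(1,3)] that by (simp add: kernel_def)
  ultimately show ?thesis using fin c.normal_kernel by blast
qed

end
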